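(* Let $\mathcal{F}_3$ be the class of all $f\in\mathcal{A}$ with $\operatorname{Re}\bigl(f(z)/(z+z^2/2)\bigr)>0$ for all $z\in\mathbb{D}$. Write $R_{\mathcal{G}}$ for the $\mathcal{G}$-radius $R_{\mathcal{G}}(\mathcal{F}_3)$ of $\mathcal{F}_3$. Then the following (sharp) radii results hold for $\mathcal{F}_3$: (i) For any $0\le\alpha<1$, the radius $R_{\mathcal{S}^*(\alpha)}$ is the smallest positive root of the equation $(2-\alpha)r^3+2\alpha r^2+(\alpha-6)r+2-2\alpha=0$. (ii) The radius $R_{\mathcal{S}^*_L}$ ($\approx 0.1645$) is the smallest positive root of the equation $(\sqrt2-2)r^3+2\sqrt2\,r^2+(6-\sqrt2)r+2-2\sqrt2=0$. (iii) $R_{\mathcal{S}^*_P}=R_{\mathcal{S}^*(1/2)}$ ($\approx 0.19028$). (iv) $R_{\mathcal{S}^*_e}=R_{\mathcal{S}^*(1/e)}$ ($\approx 0.2355$). (v) $R_{\mathcal{S}^*_{\sin}}=R_{\mathcal{S}^*(1-\sin 1)}$ ($\approx 0.3017$). (vi) $R_{\mathcal{S}^*_{\mathrm{lune}}}=R_{\mathcal{S}^*(\sqrt2-1)}$ ($\approx 0.2199$). (vii) $R_{\mathcal{S}^*_R}=R_{\mathcal{S}^*(2(\sqrt2-1))}$ ($\approx 0.0679$). (viii) $R_{\mathcal{S}^*_C}=R_{\mathcal{S}^*(1/3)}$ ($\approx 0.2469$).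
   Context: Notation: $\mathbb{D}_r=\{z\in\mathbb{C}:|z|<r\}$ and $\mathbb{D}=\mathbb{D}_1$. $\mathcal{A}$ is the set of analytic functions $f:\mathbb{D}\to\mathbb{C}$ with $f(0)=0$ and $f'(0)=1$. $\mathcal{S}\subset\mathcal{A}$ is the subclass of univalent (injective) functions. The quotient $f(z)/(z+z^2/2)$ is understood at $z=0$ by its analytic extension (value $1$). For a function $f$, put $s_f(z)=zf'(z)/f(z)$ (with $s_f(0)=1$). For $0\le\alpha<1$, $\mathcal{S}^*(\alpha)$ (starlike functions of order $\alpha$) is the class of $f\in\mathcal{S}$ with $\operatorname{Re}(s_f(z))>\alpha$ for all $z\in\mathbb{D}$. Subordination: for analytic $f,g$ on $\mathbb{D}$, $f\prec g$ means there is an analytic $\omega:\mathbb{D}\to\mathbb{D}$ with $\omega(0)=0$ and $f(z)=g(\omega(z))$ for all $z\in\mathbb{D}$. For an analytic $\varphi$ on $\mathbb{D}$ let $\mathcal{S}^*(\varphi)=\{f\in\mathcal{A}: s_f\prec\varphi\}$. The following special classes are used (principal branches): - $\mathcal{S}^*_L=\mathcal{S}^*(\varphi_1)$ with $\varphi_1(z)=\sqrt{1+z}$; - $\mathcal{S}^*_e=\mathcal{S}^*(\varphi_2)$ with $\varphi_2(z)=e^z$; - $\mathcal{S}^*_C=\mathcal{S}^*(\varphi_3)$ with $\varphi_3(z)=1+\tfrac43 z+\tfrac23 z^2$; - $\mathcal{S}^*_{\sin}=\mathcal{S}^*(\varphi_4)$ with $\varphi_4(z)=1+\sin z$; - $\mathcal{S}^*_{\mathrm{lune}}=\mathcal{S}^*(\varphi_5)$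 with $\varphi_5(z)=z+\sqrt{1+z^2}$; - $\mathcal{S}^*_R=\mathcal{S}^*(\varphi_6)$ with $\varphi_6(z)=1+\dfrac{kz+z^2}{k^2-kz}$, $k=\sqrt2+1$; - $\mathcal{S}^*_P=\mathcal{S}^*(\varphi_7)$ with $\varphi_7(z)=1+\dfrac{2}{\pi^2}\Bigl(\log\dfrac{1+\sqrt z}{1-\sqrt z}\Bigr)^2$. Radius: for a class $\mathcal{F}\subset\mathcal{A}$ and a class $\mathcal{G}\subset\mathcal{A}$ characterised by a property, the $\mathcal{G}$-radius $R_{\mathcal{G}}(\mathcal{F})$ is the largest number $R\in[0,1]$ such that every $f\in\mathcal{F}$ has the property defining $\mathcal{G}$ in the disk $\mathbb{D}_r$ for each $0<r<R$; that is, the function $z\mapsto r^{-1}f(rz)$ on $\mathbb{D}$ belongs to $\mathcal{G}$ for each $0<r<R$. "Sharp" means that the stated number is this largest value. The decimal values are approximate numerical values only. *)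

theory Defs
  imports "HOL-Complex_Analysis.Complex_Analysis"
begin

text \<open>
  Functions on the unit disk are total functions on the complex plane; all the notions
  below depend only on their values in \<^term>\<open>ball (0::complex) 1\<close>.
\<close>

definition class_A :: "(complex \<Rightarrow> complex) set" where
  "class_A = {f. f holomorphic_on ball 0 1 \<and> f 0 = 0 \<and> deriv f 0 = 1}"

definition class_S :: "(complex \<Rightarrow> complex) set" where
  "class_S = {f \<in> class_A. inj_on f (ball 0 1)}"

definition s_quot :: "(complex \<Rightarrow> complex) \<Rightarrow> complex \<Rightarrow> complex" where
  "s_quot f z = (if z = 0 then 1 else z * deriv f z / f z)"

definition starlike_order :: "real \<Rightarrow> (complex \<Rightarrow> complex) set" where
  "starlike_order \<alpha> = {f \<in> class_S. \<forall>z\<in>ball 0 1. Re (s_quot f z) > \<alpha>}"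

definition subordinate :: "(complex \<Rightarrow> complex) \<Rightarrow> (complex \<Rightarrow> complex) \<Rightarrow> bool"
    (infix "\<prec>\<prec>" 50) where
  "f \<prec>\<prec> g \<longleftrightarrow> f holomorphic_on ball 0 1 \<and> g holomorphic_on ball 0 1 \<and>
     (\<exists>\<omega>. \<omega> holomorphic_on ball 0 1 \<and> \<omega> ` ball 0 1 \<subseteq> ball 0 1 \<and> \<omega> 0 = 0 \<and>
          (\<forall>z\<in>ball 0 1. f z = g (\<omega> z)))"

text \<open>
  If \<open>f \<in> class_A\<close> has a zero at some \<open>z \<noteq> 0\<close> of the disk, then \<open>s_quot f\<close> is unbounded
  near \<open>z\<close>, whatever the value of the division by zero at \<open>z\<close> itself; so it is not holomorphic
  and \<open>f\<close> is in no class \<open>starlike_sub \<phi>\<close>.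
\<close>

definition starlike_sub :: "(complex \<Rightarrow> complex) \<Rightarrow> (complex \<Rightarrow> complex) set" where
  "starlike_sub \<phi> = {f \<in> class_A. s_quot f \<prec>\<prec> \<phi>}"

definition phi_L :: "complex \<Rightarrow> complex" where
  "phi_L z = csqrt (1 + z)"

definition phi_C :: "complex \<Rightarrow> complex" where
  "phi_C z = 1 + 4/3 * z + 2/3 * z\<^sup>2"

definition phi_sin :: "complex \<Rightarrow> complex" where
  "phi_sin z = 1 + sin z"

definition phi_lune :: "complex \<Rightarrow> complex" where
  "phi_lune z = z + csqrt (1 + z\<^sup>2)"

definition phi_R :: "complex \<Rightarrow> complex" where
  "phi_R z = (let k = complex_of_real (sqrt 2 + 1) in 1 + (k * z + z\<^sup>2) / (k\<^sup>2 - k * z))"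

text \<open>
  The formula for \<open>phi_P\<close> is even in the square root of \<open>z\<close>, so the function is holomorphic
  on the whole unit disk in spite of the branch cut of \<^const>\<open>csqrt\<close>.
\<close>

definition phi_P :: "complex \<Rightarrow> complex" where
  "phi_P z = 1 + 2 / (complex_of_real pi)\<^sup>2 * (Ln ((1 + csqrt z) / (1 - csqrt z)))\<^sup>2"

abbreviation "starlike_L \<equiv> starlike_sub phi_L"
abbreviation "starlike_e \<equiv> starlike_sub exp"
abbreviation "starlike_C \<equiv> starlike_sub phi_C"
abbreviation "starlike_sin \<equiv> starlike_sub phi_sin"
abbreviation "starlike_lune \<equiv> starlike_sub phi_lune"
abbreviation "starlike_R \<equiv> starlike_sub phi_R"
abbreviation "starlike_P \<equiv> starlike_sub phi_P"

definition admissible_radius ::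
    "(complex \<Rightarrow> complex) set \<Rightarrow> (complex \<Rightarrow> complex) set \<Rightarrow> real \<Rightarrow> bool" where
  "admissible_radius G F R \<longleftrightarrow> R \<in> {0..1} \<and>
     (\<forall>f\<in>F. \<forall>r. 0 < r \<and> r < R \<longrightarrow> (\<lambda>z. f (of_real r * z) / of_real r) \<in> G)"

definition class_radius :: "(complex \<Rightarrow> complex) set \<Rightarrow> (complex \<Rightarrow> complex) set \<Rightarrow> real" where
  "class_radius G F = (GREATEST R. admissible_radius G F R)"

text \<open>The greatest admissible radius always exists.\<close>

lemma class_radius_greatest:
  "admissible_radius G F (class_radius G F)"
  "admissible_radius G F R \<Longrightarrow> R \<le> class_radius G F"
proof -
  let ?X = "Collect (admissible_radius G F)"
  have ne: "?X \<noteq> {}"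
    by (auto simp: admissible_radius_def intro!: exI[of _ 0])
  have bdd: "bdd_above ?X"
    by (rule bdd_aboveI[of _ 1]) (auto simp: admissible_radius_def)
  have upper: "R \<le> Sup ?X" if "admissible_radius G F R" for R
    using that bdd by (intro cSup_upper) auto
  have "0 \<le> Sup ?X"
    by (rule upper) (auto simp: admissible_radius_def)
  moreover have "Sup ?X \<le> 1"
    using ne by (intro cSup_least) (auto simp: admissible_radius_def)
  moreover have "(\<lambda>z. f (of_real r * z) / of_real r) \<in> G"
    if fr: "f \<in> F" "0 < r" "r < Sup ?X" for f r
  proof -
    obtain R where "admissible_radius G F R" "r < R"
      using less_cSupE[OF fr(3) ne] by auto
    with fr show ?thesis by (auto simp: admissible_radius_def)
  qed
  ultimately have adm: "admissible_radius G F (Sup ?X)"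
    by (auto simp: admissible_radius_def)
  have eq: "class_radius G F = Sup ?X"
    unfolding class_radius_def using adm upper by (rule Greatest_equality)
  show "admissible_radius G F (class_radius G F)"
    using adm by (simp add: eq)
  show "admissible_radius G F R \<Longrightarrow> R \<le> class_radius G F"
    using upper by (simp add: eq)
qed

definition class_F3 :: "(complex \<Rightarrow> complex) set" where
  "class_F3 = {f \<in> class_A. \<forall>z\<in>ball 0 1.
     Re (if z = 0 then 1 else f z / (z + z\<^sup>2 / 2)) > 0}"

definition smallest_positive_root :: "(real \<Rightarrow> real) \<Rightarrow> real \<Rightarrow> bool" where
  "smallest_positive_root p R \<longleftrightarrow> 0 < R \<and> p R = 0 \<and> (\<forall>x. 0 < x \<and> p x = 0 \<longrightarrow> R \<le> x)"

end

theory Submission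
  imports Defs
begin

text \<open>
  Write \<open>f z = (z + z\<^sup>2/2) p z\<close> with \<open>Re p > 0\<close> and \<open>p 0 = 1\<close>, so that
  \<open>s_quot f z = 1 + z/(2 + z) + z p' z / p z\<close>. Schwarz's lemma bounds the last term by
  \<open>2r/(1 - r\<^sup>2)\<close> on \<open>norm z = r\<close>, with equality at \<open>-r\<close> and \<open>r\<close> for
  \<open>p z = (1 + z)/(1 - z)\<close>. Except for the lemniscate, every class is given by a region
  that contains the disc about 1 whose leftmost point is \<open>\<alpha> = \<phi> (-1)\<close> and omits \<open>\<alpha>\<close> itself.
  Hence the radius depends on \<open>\<alpha>\<close> only and is the one for starlikeness of order \<open>\<alpha>\<close>. For the
  lemniscate the binding point is \<open>sqrt 2\<close>, on the right.
\<close>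

subsection \<open>Starlike functions and the class of the theorem\<close>

text \<open>The terms z/(2 + z) and z p'(z)/p(z) are estimated separately and added about 1. Nothing
  is lost at z = -r: there |z/(2 + z)| is largest on the circle, and for the extremal p both terms
  are negative. So a disc about 1 is sharp whenever the binding point lies on the left. At z = r the
  modulus |z/(2 + z)| is smallest, the disc about 1 overshoots on the right, and the lemniscate
  needs the exact image of the circle under 1 + z/(2 + z), whose centre moves with r. Subordination
  demands an actual Schwarz function. It is obtained as \<open>\<psi> \<circ> s_quot g\<close> with
  an explicit holomorphic right inverse \<open>\<psi>\<close> of \<open>\<phi>\<close> on the disc;
  from class to class only the formula for \<open>\<psi>\<close> and the proof that it has modulus
  below 1 change. Sharpness rests on one observation: a dilation of the extremal function by more
  than R has the critical value at an interior point of the disc, whereas no interior point is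
  mapped to that value by \<open>\<phi>\<close>.\<close>

text \<open>Infinitesimal Schwarz-Pick inequality for the half-plane. The disc automorphism
  \<open>M\<close> sends 0 to \<open>a\<close>, a Moebius map sends the half-plane to the disc and
  \<open>p a\<close> to 0, and Schwarz's lemma bounds the derivative at 0 of their composition
  \<open>g\<close> with \<open>p\<close>.\<close>

lemma deriv_half_plane_bound:
  assumes holp: "p holomorphic_on ball 0 1"
    and pos: "\<And>z. z \<in> ball 0 1 \<Longrightarrow> Re (p z) > 0"
    and a: "norm a < 1"
  shows "norm (deriv p a) * (1 - (norm a)\<^sup>2) \<le> 2 * Re (p a)"
proof -
  define M where "M z = (z + a) / (1 + cnj a * z)" for z
  have nz: "1 + cnj a * z \<noteq> 0" if "norm z < 1" for z
  proof
    assume "1 + cnj a * z = 0"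
    then have "cnj a * z = -1" by (simp add: add_eq_0_iff)
    then have "norm a * norm z = 1"
      by (metis complex_mod_cnj norm_minus_cancel norm_mult norm_one)
    moreover have "norm a * norm z \<le> norm a * 1"
      using that by (intro mult_left_mono) auto
    ultimately show False using a by simp
  qed
  have Mball: "norm (M z) < 1" if z: "norm z < 1" for z
  proof -
    have "(norm (1 + cnj a * z))\<^sup>2 - (norm (z + a))\<^sup>2 = (1 - (norm a)\<^sup>2) * (1 - (norm z)\<^sup>2)"
      unfolding cmod_power2 by (simp add: algebra_simps power2_eq_square)
    also have "\<dots> > 0"
      using a z by (simp add: power_less_one_iff abs_square_less_1)
    finally have "norm (z + a) < norm (1 + cnj a * z)"
      using power2_less_imp_less by fastforce
    then show ?thesis
      using nz[OF z] by (simp add: M_def norm_divide)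
  qed
  define P where "P z = p (M z)" for z
  have holM: "M holomorphic_on ball 0 1"
    unfolding M_def using nz by (intro holomorphic_intros) auto
  have holP: "P holomorphic_on ball 0 1"
    unfolding P_def using holomorphic_on_compose_gen[OF holM holp] Mball
    by (force simp: o_def)
  have posP: "Re (P z) > 0" if "norm z < 1" for z
    unfolding P_def using pos Mball[OF that] by simp
  define g where "g z = (P z - p a) / (P z + cnj (p a))" for z
  have nz2: "P z + cnj (p a) \<noteq> 0" if "norm z < 1" for z
  proof -
    have "Re (P z + cnj (p a)) > 0"
      using posP[OF that] pos[of a] a by simp
    then show ?thesis by force
  qed
  have holg: "g holomorphic_on ball 0 1"
    unfolding g_def using nz2 holP by (intro holomorphic_intros) auto
  have P0: "P 0 = p a" by (simp add: P_def M_def)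
  have gball: "norm (g z) < 1" if z: "norm z < 1" for z
  proof -
    have "(norm (P z + cnj (p a)))\<^sup>2 - (norm (P z - p a))\<^sup>2 = 4 * Re (P z) * Re (p a)"
      unfolding cmod_power2 by (simp add: algebra_simps power2_eq_square)
    also have "\<dots> > 0"
      using posP[OF z] pos[of a] a by simp
    finally have "norm (P z - p a) < norm (P z + cnj (p a))"
      using power2_less_imp_less by fastforce
    then show ?thesis
      using nz2[OF z] by (simp add: g_def norm_divide)
  qed
  have "g 0 = 0" by (simp add: g_def P0)
  then have "norm (deriv g 0) \<le> 1"
    using Schwarz_Lemma(2)[OF holg _ gball, of 0] by simp
  moreover have "deriv g 0 = deriv p a * (1 - (norm a)\<^sup>2) / (2 * Re (p a))"
  proof -
    have n: "1 - (norm a)\<^sup>2 = 1 - cnj a * a"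
      using complex_norm_square[of a] by (simp add: mult.commute)
    have dM: "(M has_field_derivative (1 - (norm a)\<^sup>2)) (at 0)"
      unfolding M_def n by (rule derivative_eq_intros refl | simp)+
    have dp: "(p has_field_derivative deriv p a) (at (M 0))"
      using holomorphic_derivI[OF holp open_ball, of a] a by (simp add: M_def)
    have dP: "(P has_field_derivative deriv p a * (1 - (norm a)\<^sup>2)) (at 0)"
      using DERIV_chain2[OF dp dM] unfolding P_def by simp
    have "(g has_field_derivative deriv p a * (1 - (norm a)\<^sup>2) / (2 * Re (p a))) (at 0)"
      unfolding g_def using nz2[of 0]
      by (auto intro!: derivative_eq_intros dP simp: P0 complex_add_cnj field_simps)
    then show ?thesis by (rule DERIV_imp_deriv)
  qed
  moreover have 1: "2 * Re (p a) > 0" using pos a by simp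
  moreover have 2: "1 - (norm a)\<^sup>2 > 0" using a by (simp add: abs_square_less_1)
  ultimately have "norm (deriv p a) * (1 - (norm a)\<^sup>2) / (2 * Re (p a)) \<le> 1"
    by (simp only: norm_mult norm_divide norm_of_real abs_of_pos)
  then show ?thesis using 1 by (simp only: pos_divide_le_eq mult_1)
qed

text \<open>A zero of \<open>f\<close> at some z other than 0 would give
  \<open>s_quot f z = 0\<close>, as division by zero yields 0; the hypothesis excludes this. So f z
  / z extends to a zero-free function on a convex set and has a holomorphic logarithm.\<close>

lemma s_quot_log:
  assumes f: "f \<in> class_A" and pos: "\<And>z. z \<in> ball 0 1 \<Longrightarrow> s_quot f z \<noteq> 0"
  obtains k where "k holomorphic_on ball 0 1"
    "\<And>z. z \<in> ball 0 1 \<Longrightarrow> f z = z * exp (k z)"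
    "\<And>z. z \<in> ball 0 1 \<Longrightarrow> s_quot f z = 1 + z * deriv k z"
proof -
  define h where "h z = (if z = 0 then deriv f 0 else (f z - f 0) / (z - 0))" for z
  have f0: "f 0 = 0" "deriv f 0 = 1" and holf: "f holomorphic_on ball 0 1"
    using f by (auto simp: class_A_def)
  have holh: "h holomorphic_on ball 0 1"
    unfolding h_def by (rule pole_lemma_open) (use holf in auto)
  have fz: "f z = z * h z" for z
    by (simp add: h_def f0)
  have hnz: "h z \<noteq> 0" if "z \<in> ball 0 1" for z
    using pos[OF that] by (auto simp: h_def f0 s_quot_def split: if_splits)
  obtain k where k: "k holomorphic_on ball 0 1" "\<And>z. z \<in> ball 0 1 \<Longrightarrow> exp (k z) = h z"
    using holomorphic_logarithm_exists[OF convex_ball open_ball holh hnz, of 0] by auto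
  have "s_quot f z = 1 + z * deriv k z" if z: "z \<in> ball 0 1" for z
  proof (cases "z = 0")
    case False
    have dk: "(k has_field_derivative deriv k z) (at z)"
      using holomorphic_derivI[OF k(1) open_ball z] .
    have "((\<lambda>z. z * exp (k z)) has_field_derivative exp (k z) * (1 + z * deriv k z)) (at z)"
      by (auto intro!: derivative_eq_intros dk simp: algebra_simps)
    then have "(f has_field_derivative exp (k z) * (1 + z * deriv k z)) (at z)"
      using has_field_derivative_transform_within_open[OF _ open_ball z, where g = f] fz k(2) by auto
    then show ?thesis
      using False z by (simp add: s_quot_def DERIV_imp_deriv fz k(2)[symmetric])
  qed (simp add: s_quot_def)
  with k fz that show ?thesis by metis
qed

text \<open>
  With \<open>f z = z * exp (k z)\<close>, the function \<open>g u = u + k (exp u)\<close> is a logarithm of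
  \<open>f (exp u)\<close> on the left half-plane, and \<open>g' u = s_quot f (exp u)\<close> has positive real part
  on this convex set, so \<open>g\<close> is injective.
\<close>
lemma starlike_imp_inj_on:
  assumes f: "f \<in> class_A" and pos: "\<And>z. z \<in> ball 0 1 \<Longrightarrow> Re (s_quot f z) > 0"
  shows "inj_on f (ball 0 1)"
proof -
  have "s_quot f z \<noteq> 0" if "z \<in> ball 0 1" for z
    using pos[OF that] by force
  then obtain k where holk: "k holomorphic_on ball 0 1"
    and fk: "\<And>z. z \<in> ball 0 1 \<Longrightarrow> f z = z * exp (k z)"
    and sk: "\<And>z. z \<in> ball 0 1 \<Longrightarrow> s_quot f z = 1 + z * deriv k z"
    using s_quot_log[OF f] by metis
  define g where "g u = u + k (exp u)" for u
  define H where "H = {u::complex. Re u < 0}"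
  have eH: "exp u \<in> ball 0 1" if "u \<in> H" for u
    using that by (simp add: H_def)
  have dg: "(g has_field_derivative s_quot f (exp u)) (at u)" if "u \<in> H" for u
  proof -
    have "(k has_field_derivative deriv k (exp u)) (at (exp u))"
      using holomorphic_derivI[OF holk open_ball eH[OF that]] .
    from DERIV_chain2[OF this DERIV_exp] show ?thesis
      unfolding g_def sk[OF eH[OF that]]
      by (auto intro!: derivative_eq_intros simp: mult.commute)
  qed
  have inj: "u = v" if uv: "u \<in> H" "v \<in> H" "g u = g v" for u v
  proof (rule ccontr)
    assume "u \<noteq> v"
    have seg: "x \<in> H" if "x \<in> closed_segment u v" for x
      using that uv convex_halfspace_Re_lt[of 0] closed_segment_subset[of u H v]
      by (auto simp: H_def)
    \<comment> \<open>The mean value theorem on a segment controls real parts only. Dividing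
      \<open>g\<close> by the constant \<open>v - u\<close> makes the right-hand side the real part
      of \<open>s_quot f (exp x)\<close>, which is positive, while the left-hand side is 0.\<close>
    obtain x where x: "x \<in> closed_segment u v"
      "Re (g v / (v - u)) - Re (g u / (v - u)) = Re (s_quot f (exp x) / (v - u) * (v - u))"
      using complex_mvt_line[of u v "\<lambda>x. g x / (v - u)" "\<lambda>x. s_quot f (exp x) / (v - u)"]
        DERIV_cdivide[OF dg[OF seg]] by blast
    then show False
      using uv \<open>u \<noteq> v\<close> pos[OF eH[OF seg[OF x(1)]]] by simp
  qed
  show ?thesis
  proof (rule inj_onI)
    fix z w assume zw: "z \<in> ball 0 1" "w \<in> ball 0 1" "f z = f w"
    show "z = w"
    proof (cases "z = 0 \<or> w = 0")
      case True
      then show ?thesis using zw fk by auto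
    next
      case False
      then have LnH: "Ln z \<in> H" "Ln w \<in> H"
        using zw by (auto simp: H_def)
      have "exp (g (Ln z)) = exp (g (Ln w))"
        using False zw fk by (simp add: g_def exp_add)
      \<comment> \<open>The logarithms agree only up to a period. Moving \<open>Ln w\<close>
        vertically by that period stays in the half-plane and moves \<open>g\<close> by the same
        amount, because \<open>k (exp u)\<close> is periodic.\<close>
      then obtain n :: int where n: "g (Ln z) = g (Ln w) + of_int (2 * n) * pi * \<i>"
        using exp_eq by auto
      have e: "exp (Ln w + of_int (2 * n) * pi * \<i>) = w"
        using exp_eq[of "Ln w + of_int (2 * n) * pi * \<i>" "Ln w"] False by auto
      have "Ln w + of_int (2 * n) * pi * \<i> \<in> H"
        using LnH by (simp add: H_def)
      moreover have "g (Ln z) = g (Ln w + of_int (2 * n) * pi * \<i>)"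
        using n False e by (simp add: g_def)
      ultimately have "Ln z = Ln w + of_int (2 * n) * pi * \<i>"
        using inj LnH by blast
      then show ?thesis using e False by (metis exp_Ln)
    qed
  qed
qed

lemma dilation_class_A:
  assumes f: "f \<in> class_A" and r: "0 < r" "r \<le> 1"
  shows "(\<lambda>z. f (of_real r * z) / of_real r) \<in> class_A" (is "?g \<in> _")
    and "\<And>z. z \<in> ball 0 1 \<Longrightarrow> s_quot (\<lambda>z. f (of_real r * z) / of_real r) z = s_quot f (of_real r * z)"
proof -
  have f0: "f 0 = 0" "deriv f 0 = 1" and holf: "f holomorphic_on ball 0 1"
    using f by (auto simp: class_A_def)
  have rz: "of_real r * z \<in> ball 0 1" if "z \<in> ball 0 1" for z :: complex
    using that r mult_left_le_one_le[of "norm z" r] by (auto simp: norm_mult)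
  have d: "(?g has_field_derivative deriv f (of_real r * z)) (at z)" if "z \<in> ball 0 1" for z
  proof -
    have 1: "(f has_field_derivative deriv f (of_real r * z)) (at (of_real r * z))"
      using holomorphic_derivI[OF holf open_ball rz[OF that]] .
    have 2: "((\<lambda>z. of_real r * z) has_field_derivative of_real r) (at z)"
      by (auto intro!: derivative_eq_intros)
    show ?thesis
      using DERIV_cdivide[OF DERIV_chain2[where g = "\<lambda>z. of_real r * z", OF 1 2], of "of_real r"] r
      by simp
  qed
  then have "?g holomorphic_on ball 0 1"
    by (meson holomorphic_on_open open_ball)
  then show "?g \<in> class_A"
    using d[of 0] f0 by (simp add: class_A_def DERIV_imp_deriv)
  show "s_quot ?g z = s_quot f (of_real r * z)" if "z \<in> ball 0 1" for z
    using d[OF that] r by (simp add: s_quot_def DERIV_imp_deriv)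
qed

section \<open>Members of the class as products (z + z^2/2) p(z)\<close>

lemma quadratic_factor: "z + z\<^sup>2 / 2 = z * (2 + z) / 2" for z :: complex
  by (simp add: power2_eq_square algebra_simps)

lemma quadratic_nonzero: "z + z\<^sup>2 / 2 \<noteq> 0" if "norm z < 1" "z \<noteq> 0" for z :: complex
  unfolding quadratic_factor using that by (auto simp: add_eq_0_iff)

lemma class_F3_I:
  assumes holp: "p holomorphic_on ball 0 1" and p0: "p 0 = 1"
    and pos: "\<And>z. z \<in> ball 0 1 \<Longrightarrow> Re (p z) > 0"
  shows "(\<lambda>z. (z + z\<^sup>2 / 2) * p z) \<in> class_F3" (is "?f \<in> _")
proof -
  have "?f holomorphic_on ball 0 1"
    by (intro holomorphic_intros holp) auto
  moreover have "(p has_field_derivative deriv p 0) (at 0)"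
    using holomorphic_derivI[OF holp open_ball, of 0] by simp
  then have "(?f has_field_derivative 1) (at 0)"
    by (auto intro!: derivative_eq_intros simp: p0)
  ultimately show ?thesis
    using pos quadratic_nonzero by (auto simp: class_F3_def class_A_def DERIV_imp_deriv)
qed

text \<open>The quotient must be holomorphic at 0 as well. \<open>h\<close> is f z / z with its
  removable singularity filled in, and the remaining factor 1 + z/2 has no zero in the disc.\<close>

lemma class_F3_E:
  assumes f: "f \<in> class_F3"
  obtains p where "p holomorphic_on ball 0 1" "p 0 = 1"
    "\<And>z. z \<in> ball 0 1 \<Longrightarrow> Re (p z) > 0"
    "\<And>z. z \<in> ball 0 1 \<Longrightarrow> f z = (z + z\<^sup>2 / 2) * p z"
proof -
  define h where "h z = (if z = 0 then deriv f 0 else (f z - f 0) / (z - 0))" for z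
  have f0: "f 0 = 0" "deriv f 0 = 1" and holf: "f holomorphic_on ball 0 1"
    and pos: "\<And>z. z \<in> ball 0 1 \<Longrightarrow> Re (if z = 0 then 1 else f z / (z + z\<^sup>2 / 2)) > 0"
    using f by (auto simp: class_F3_def class_A_def)
  have holh: "h holomorphic_on ball 0 1"
    unfolding h_def by (rule pole_lemma_open) (use holf in auto)
  have nz: "1 + z / 2 \<noteq> 0" if "norm z < 1" for z :: complex
    using that by (auto simp: add_eq_0_iff)
  define p where "p z = h z / (1 + z / 2)" for z
  have eq: "p z = (if z = 0 then 1 else f z / (z + z\<^sup>2 / 2))" if "z \<in> ball 0 1" for z
  proof (cases "z = 0")
    case False
    have "z + z\<^sup>2 / 2 = z * (1 + z / 2)"
      by (simp add: power2_eq_square algebra_simps)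
    then show ?thesis using False by (simp add: p_def h_def f0)
  qed (simp add: p_def h_def f0)
  show ?thesis
  proof
    show "p holomorphic_on ball 0 1"
      unfolding p_def using nz by (intro holomorphic_intros holh) auto
    show "p 0 = 1" by (simp add: eq)
    show "Re (p z) > 0" if "z \<in> ball 0 1" for z
      using pos[OF that] by (simp only: eq[OF that])
    show "f z = (z + z\<^sup>2 / 2) * p z" if "z \<in> ball 0 1" for z
      using eq[OF that] quadratic_nonzero[of z] that by (cases "z = 0") (auto simp: f0)
  qed
qed

lemma s_quot_product:
  assumes holp: "p holomorphic_on ball 0 1" and nz: "\<And>z. z \<in> ball 0 1 \<Longrightarrow> p z \<noteq> 0"
    and f: "\<And>z. z \<in> ball 0 1 \<Longrightarrow> f z = (z + z\<^sup>2 / 2) * p z" and z: "z \<in> ball 0 1"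
  shows "s_quot f z = 1 + z / (2 + z) + z * deriv p z / p z"
proof (cases "z = 0")
  case False
  have n2: "2 + z \<noteq> 0" using z by (auto simp: add_eq_0_iff)
  have dp: "(p has_field_derivative deriv p z) (at z)"
    using holomorphic_derivI[OF holp open_ball z] .
  have "((\<lambda>z. (z + z\<^sup>2 / 2) * p z) has_field_derivative (1 + z) * p z + (z + z\<^sup>2 / 2) * deriv p z) (at z)"
    by (auto intro!: derivative_eq_intros dp simp: algebra_simps)
  then have "(f has_field_derivative (1 + z) * p z + (z + z\<^sup>2 / 2) * deriv p z) (at z)"
    using has_field_derivative_transform_within_open[OF _ open_ball z, where g = f] f by auto
  then have "s_quot f z = z * ((1 + z) * p z + (z + z\<^sup>2 / 2) * deriv p z) / ((z + z\<^sup>2 / 2) * p z)"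
    using False f[OF z] by (simp add: s_quot_def DERIV_imp_deriv)
  also note quadratic_factor
  also have "z * ((1 + z) * p z + z * (2 + z) / 2 * deriv p z) / (z * (2 + z) / 2 * p z)
    = 1 + z / (2 + z) + z * deriv p z / p z"
    using n2 False nz[OF z] by (simp add: divide_simps)
  finally show ?thesis .
qed (simp add: s_quot_def)

subsection \<open>The disc of values and the radius\<close>

text \<open>
  For \<open>f\<close> in the class, \<open>s_quot f\<close> maps the circle of radius \<open>r\<close> into the disc with
  diameter from \<open>disc_min r\<close> to \<open>disc_max r\<close>; the extremal function attains both end points,
  at \<open>-r\<close> and \<open>r\<close>.
\<close>
definition disc_min :: "real \<Rightarrow> real" where
  "disc_min r = 2 * (1 - r) / (2 - r) - 2 * r / (1 - r\<^sup>2)"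

definition disc_max :: "real \<Rightarrow> real" where
  "disc_max r = 2 * (1 + r) / (2 + r) + 2 * r / (1 - r\<^sup>2)"

section \<open>Monotonicity of the end points and their cubic equations\<close>

lemma real_sq_less_1: "r\<^sup>2 < 1" if "0 \<le> r" "r < 1" for r :: real
  using that by (simp add: abs_square_less_1)

lemma strict_mono_pole_term:
  assumes "0 \<le> x" "x < y" "y < 1"
  shows "2 * x / (1 - x\<^sup>2) < 2 * y / (1 - y\<^sup>2 :: real)"
  using assms real_sq_less_1[of x] real_sq_less_1[of y]
  by (intro frac_less) (auto intro!: power_mono)

lemma disc_min_strict_antimono:
  assumes "0 \<le> x" "x < y" "y < 1"
  shows "disc_min y < disc_min x"
proof -
  have "2 * (1 - y) / (2 - y) \<le> 2 * (1 - x) / (2 - x)"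
    using assms by (simp add: divide_simps) (simp add: algebra_simps)
  with strict_mono_pole_term[OF assms] show ?thesis
    by (simp add: disc_min_def)
qed

lemma disc_max_strict_mono:
  assumes "0 \<le> x" "x < y" "y < 1"
  shows "disc_max x < disc_max y"
proof -
  have "2 * (1 + x) / (2 + x) \<le> 2 * (1 + y) / (2 + y)"
    using assms by (simp add: divide_simps) (simp add: algebra_simps)
  with strict_mono_pole_term[OF assms] show ?thesis
    by (simp add: disc_max_def)
qed

text \<open>The cubic arises by clearing the denominators of disc_min r = \<alpha>. The cleared
  factor is positive on [0, 1), so both equations have the same solutions there.\<close>

lemma disc_min_cubic:
  assumes "0 \<le> r" "r < 1"
  shows "(2 - \<alpha>) * r ^ 3 + 2 * \<alpha> * r ^ 2 + (\<alpha> - 6) * r + 2 - 2 * \<alpha>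
    = (disc_min r - \<alpha>) * ((2 - r) * (1 - r\<^sup>2))"
proof -
  have "2 - r \<noteq> 0" "1 - r\<^sup>2 \<noteq> 0" using assms real_sq_less_1[of r] by auto
  then have "disc_min r * ((2 - r) * (1 - r\<^sup>2)) = 2 * (1 - r) * (1 - r\<^sup>2) - 2 * r * (2 - r)"
    unfolding disc_min_def by (simp add: divide_simps)
  then show ?thesis
    unfolding left_diff_distrib[of "disc_min r"] by (simp add: algebra_simps power2_eq_square power3_eq_cube)
qed

lemma disc_max_cubic:
  assumes "0 \<le> r" "r < 1"
  shows "(b - 2) * r ^ 3 + 2 * b * r ^ 2 + (6 - b) * r + 2 - 2 * b
    = (disc_max r - b) * ((2 + r) * (1 - r\<^sup>2))"
proof -
  have "2 + r \<noteq> 0" "1 - r\<^sup>2 \<noteq> 0" using assms real_sq_less_1[of r] by auto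
  then have "disc_max r * ((2 + r) * (1 - r\<^sup>2)) = 2 * (1 + r) * (1 - r\<^sup>2) + 2 * r * (2 + r)"
    unfolding disc_max_def by (simp add: divide_simps)
  then show ?thesis
    unfolding left_diff_distrib[of "disc_max r"] by (simp add: algebra_simps power2_eq_square power3_eq_cube)
qed

lemma disc_min_root_exists:
  assumes "\<alpha> < 1"
  obtains R where "0 < R" "R < 1" "disc_min R = \<alpha>"
proof -
  define P where "P r = (2 - \<alpha>) * r ^ 3 + 2 * \<alpha> * r ^ 2 + (\<alpha> - 6) * r + 2 - 2 * \<alpha>" for r
  \<comment> \<open>The intermediate value theorem is applied to the cubic because
    \<open>disc_min\<close> has a pole at 1. The end values are
    \<open>P 0 = 2 - 2 * \<alpha>\<close>, which is positive, and \<open>P 1 = -2\<close>.\<close>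
  have "\<exists>x\<ge>0. x \<le> 1 \<and> P x = 0"
    by (rule IVT2) (use assms in \<open>auto simp: P_def\<close>)
  then obtain R where R: "0 \<le> R" "R \<le> 1" "P R = 0" by blast
  moreover have "P 0 \<noteq> 0" "P 1 \<noteq> 0" using assms by (auto simp: P_def)
  ultimately have "0 < R" "R < 1" by (metis less_eq_real_def)+
  moreover have "(2 - R) * (1 - R\<^sup>2) \<noteq> 0"
    using real_sq_less_1[of R] \<open>0 < R\<close> \<open>R < 1\<close> by simp
  moreover have "(disc_min R - \<alpha>) * ((2 - R) * (1 - R\<^sup>2)) = 0"
    using disc_min_cubic[of R \<alpha>] R(3) \<open>0 < R\<close> \<open>R < 1\<close> by (simp add: P_def)
  ultimately show ?thesis
    using that by (metis eq_iff_diff_eq_0 mult_eq_0_iff)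
qed

lemma disc_max_root_exists:
  assumes "1 < b"
  obtains R where "0 < R" "R < 1" "disc_max R = b"
proof -
  define P where "P r = (b - 2) * r ^ 3 + 2 * b * r ^ 2 + (6 - b) * r + 2 - 2 * b" for r
  have "\<exists>x\<ge>0. x \<le> 1 \<and> P x = 0"
    by (rule IVT) (use assms in \<open>auto simp: P_def\<close>)
  then obtain R where R: "0 \<le> R" "R \<le> 1" "P R = 0" by blast
  moreover have "P 0 \<noteq> 0" "P 1 \<noteq> 0" using assms by (auto simp: P_def)
  ultimately have "0 < R" "R < 1" by (metis less_eq_real_def)+
  moreover have "(2 + R) * (1 - R\<^sup>2) \<noteq> 0"
    using real_sq_less_1[of R] \<open>0 < R\<close> \<open>R < 1\<close> by simp
  moreover have "(disc_max R - b) * ((2 + R) * (1 - R\<^sup>2)) = 0"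
    using disc_max_cubic[of R b] R(3) \<open>0 < R\<close> \<open>R < 1\<close> by (simp add: P_def)
  ultimately show ?thesis
    using that by (metis eq_iff_diff_eq_0 mult_eq_0_iff)
qed

lemma disc_min_smallest_root:
  assumes R: "0 < R" "R < 1" "disc_min R = \<alpha>"
  shows "smallest_positive_root
    (\<lambda>r. (2 - \<alpha>) * r ^ 3 + 2 * \<alpha> * r ^ 2 + (\<alpha> - 6) * r + 2 - 2 * \<alpha>) R"
  unfolding smallest_positive_root_def
proof (intro conjI allI impI)
  fix x assume x: "0 < x \<and> (2 - \<alpha>) * x ^ 3 + 2 * \<alpha> * x ^ 2 + (\<alpha> - 6) * x + 2 - 2 * \<alpha> = 0"
  show "R \<le> x"
  proof (rule ccontr)
    assume "\<not> R \<le> x"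
    then have "x < R" by simp
    moreover have "(2 - x) * (1 - x\<^sup>2) \<noteq> 0"
      using real_sq_less_1[of x] x \<open>x < R\<close> R(2) by simp
    then have "disc_min x = \<alpha>"
      using x \<open>x < R\<close> R(2) disc_min_cubic[of x \<alpha>] by simp
    ultimately show False
      using disc_min_strict_antimono[of x R] x R by simp
  qed
qed (use R disc_min_cubic[of R \<alpha>] in auto)

lemma disc_max_smallest_root:
  assumes R: "0 < R" "R < 1" "disc_max R = b"
  shows "smallest_positive_root
    (\<lambda>r. (b - 2) * r ^ 3 + 2 * b * r ^ 2 + (6 - b) * r + 2 - 2 * b) R"
  unfolding smallest_positive_root_def
proof (intro conjI allI impI)
  fix x assume x: "0 < x \<and> (b - 2) * x ^ 3 + 2 * b * x ^ 2 + (6 - b) * x + 2 - 2 * b = 0"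
  show "R \<le> x"
  proof (rule ccontr)
    assume "\<not> R \<le> x"
    then have "x < R" by simp
    moreover have "(2 + x) * (1 - x\<^sup>2) \<noteq> 0"
      using real_sq_less_1[of x] x \<open>x < R\<close> R(2) by simp
    then have "disc_max x = b"
      using x \<open>x < R\<close> R(2) disc_max_cubic[of x b] by simp
    ultimately show False
      using disc_max_strict_mono[of x R] x R by simp
  qed
qed (use R disc_max_cubic[of R b] in auto)

section \<open>Values on a circle and the extremal function\<close>

lemma norm_two_plus: "2 - norm z \<le> norm (2 + z)" for z :: complex
  using norm_triangle_ineq2[of 2 "-z"] by simp

text \<open>Only z p'/p remains to be estimated, by the half-plane bound and Re p \<le> |p|. The
  centre 1 + z/(2 + z) is kept, so that the estimate can be completed both about 1 and about the
  moving centre of the lemniscate case.\<close>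

lemma class_F3_s_quot:
  assumes f: "f \<in> class_F3"
  shows "s_quot f holomorphic_on ball 0 1"
    and "z \<in> ball 0 1 \<Longrightarrow>
      norm (s_quot f z - (1 + z / (2 + z))) \<le> 2 * norm z / (1 - (norm z)\<^sup>2)"
proof -
  obtain p where p: "p holomorphic_on ball 0 1" "p 0 = 1"
    "\<And>z. z \<in> ball 0 1 \<Longrightarrow> Re (p z) > 0"
    "\<And>z. z \<in> ball 0 1 \<Longrightarrow> f z = (z + z\<^sup>2 / 2) * p z"
    using class_F3_E[OF f] by metis
  have pnz: "p z \<noteq> 0" if "z \<in> ball 0 1" for z
    using p(3)[OF that] by force
  have n2: "2 + z \<noteq> 0" if "z \<in> ball 0 1" for z :: complex
    using that by (auto simp: add_eq_0_iff)
  have eq: "s_quot f z = 1 + z / (2 + z) + z * deriv p z / p z" if "z \<in> ball 0 1" for z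
    using s_quot_product[OF p(1) pnz p(4) that] .
  have "(\<lambda>z. 1 + z / (2 + z) + z * deriv p z / p z) holomorphic_on ball 0 1"
    using pnz n2 by (intro holomorphic_intros p(1) holomorphic_deriv) auto
  then show "s_quot f holomorphic_on ball 0 1"
    by (rule holomorphic_transform) (simp add: eq)
  show "norm (s_quot f z - (1 + z / (2 + z))) \<le> 2 * norm z / (1 - (norm z)\<^sup>2)"
    if z: "z \<in> ball 0 1"
  proof -
    have "norm (deriv p z) * (1 - (norm z)\<^sup>2) \<le> 2 * Re (p z)"
      using deriv_half_plane_bound[OF p(1) p(3)] z by auto
    also have "\<dots> \<le> 2 * norm (p z)"
      using complex_Re_le_cmod[of "p z"] by simp
    finally have "norm (deriv p z) / norm (p z) \<le> 2 / (1 - (norm z)\<^sup>2)"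
      using pnz[OF z] real_sq_less_1[of "norm z"] z by (simp add: field_simps)
    then have "norm z * (norm (deriv p z) / norm (p z)) \<le> norm z * (2 / (1 - (norm z)\<^sup>2))"
      by (intro mult_left_mono) auto
    then show ?thesis
      by (simp add: eq[OF z] norm_mult norm_divide mult.commute)
  qed
qed

lemma class_F3_s_quot_disc:
  assumes f: "f \<in> class_F3" and z: "z \<in> ball 0 1"
  shows "norm (s_quot f z - 1) \<le> 1 - disc_min (norm z)"
proof -
  have n2: "0 < 2 - norm z" "0 < norm (2 + z)"
    using norm_two_plus[of z] z by auto
  have "norm (s_quot f z - 1) \<le> norm (s_quot f z - (1 + z / (2 + z))) + norm (z / (2 + z))"
    using norm_triangle_ineq[of "s_quot f z - (1 + z / (2 + z))" "z / (2 + z)"] by simp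
  also have "\<dots> \<le> 2 * norm z / (1 - (norm z)\<^sup>2) + norm z / (2 - norm z)"
    unfolding norm_divide using norm_two_plus[of z] n2 class_F3_s_quot(2)[OF f z]
    by (intro add_mono divide_left_mono mult_pos_pos) auto
  also have "\<dots> = 1 - disc_min (norm z)"
    unfolding disc_min_def using z by (simp add: field_simps)
  finally show ?thesis .
qed

definition extremal_F3 :: "complex \<Rightarrow> complex" where
  "extremal_F3 z = (z + z\<^sup>2 / 2) * ((1 + z) / (1 - z))"

lemma Re_cayley_pos: "Re ((1 + z) / (1 - z)) > 0" if "norm z < 1" for z :: complex
proof -
  have nz: "1 - z \<noteq> 0" using that by auto
  have "Re ((1 + z) / (1 - z)) = (1 - (norm z)\<^sup>2) / (norm (1 - z))\<^sup>2"
    unfolding Re_divide' cmod_power2 by (simp add: power2_eq_square algebra_simps)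
  also have "\<dots> > 0" using that nz real_sq_less_1[of "norm z"] by simp
  finally show ?thesis .
qed

lemma cayley_holomorphic: "(\<lambda>z::complex. (1 + z) / (1 - z)) holomorphic_on ball 0 1"
  by (intro holomorphic_intros) auto

lemma extremal_F3_in_class: "extremal_F3 \<in> class_F3"
  unfolding extremal_F3_def[abs_def]
  by (rule class_F3_I) (use cayley_holomorphic Re_cayley_pos in auto)

lemma s_quot_extremal_F3:
  assumes "\<bar>x\<bar> < 1"
  shows "s_quot extremal_F3 (of_real x) = of_real (1 + x / (2 + x) + 2 * x / (1 - x\<^sup>2))"
proof -
  have "(1 + z) / (1 - z) \<noteq> 0" if "z \<in> ball 0 1" for z :: complex
    using Re_cayley_pos[of z] that by force
  then have "s_quot extremal_F3 (of_real x) = 1 + of_real x / (2 + of_real x)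
      + of_real x * deriv (\<lambda>z. (1 + z) / (1 - z)) (of_real x) / ((1 + of_real x) / (1 - of_real x))"
    using assms by (intro s_quot_product cayley_holomorphic) (auto simp: extremal_F3_def)
  also have "deriv (\<lambda>z. (1 + z) / (1 - z)) (of_real x) = 2 / (1 - complex_of_real x)\<^sup>2"
    using assms by (intro DERIV_imp_deriv)
      (auto intro!: derivative_eq_intros simp: power2_eq_square)
  also have "of_real x * (2 / (1 - complex_of_real x)\<^sup>2) / ((1 + of_real x) / (1 - of_real x))
      = of_real (x * (2 / (1 - x)\<^sup>2) / ((1 + x) / (1 - x)))"
    by simp
  also have "x * (2 / (1 - x)\<^sup>2) / ((1 + x) / (1 - x)) = 2 * x / (1 - x\<^sup>2)"
  proof -
    have "1 - x \<noteq> 0" "1 + x \<noteq> 0" using assms by auto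
    moreover have "1 - x\<^sup>2 = (1 - x) * (1 + x)" by (simp add: power2_eq_square algebra_simps)
    ultimately show ?thesis by (simp add: power2_eq_square)
  qed
  finally show ?thesis by simp
qed

lemma s_quot_extremal_F3_min:
  assumes "0 < r" "r < 1"
  shows "s_quot extremal_F3 (- of_real r) = of_real (disc_min r)"
proof -
  have "1 + - r / (2 + - r) + 2 * - r / (1 - (- r)\<^sup>2) = disc_min r"
    using assms by (simp add: disc_min_def field_simps)
  then show ?thesis using s_quot_extremal_F3[of "- r"] assms by (simp del: of_real_add of_real_divide)
qed

lemma s_quot_extremal_F3_max:
  assumes "0 < r" "r < 1"
  shows "s_quot extremal_F3 (of_real r) = of_real (disc_max r)"
proof -
  have "1 + r / (2 + r) + 2 * r / (1 - r\<^sup>2) = disc_max r"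
    using assms by (simp add: disc_max_def field_simps)
  then show ?thesis using s_quot_extremal_F3[of r] assms by (simp del: of_real_add of_real_divide)
qed

section \<open>From sets of values to radii\<close>

text \<open>The frame shared by all classes. Dilation by r < R leaves only values of
  \<open>s_quot\<close> at points of norm below R, which is all that \<open>inner\<close> may use.
  If the radius exceeded R, a dilation of the extremal function by some r > R would lie in
  \<open>G\<close> and have the value forbidden by \<open>outer\<close> at the interior point
  a/r.\<close>

lemma class_radius_F3_eq:
  assumes R: "0 < R" "R < 1"
    and inner: "\<And>g. \<lbrakk>g \<in> class_A; s_quot g holomorphic_on ball 0 1;
        \<And>z. z \<in> ball 0 1 \<Longrightarrow> \<exists>f\<in>class_F3. \<exists>w. norm w < R \<and> s_quot g z = s_quot f w\<rbrakk> \<Longrightarrow> g \<in> G"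
    and outer: "\<And>g z. g \<in> G \<Longrightarrow> z \<in> ball 0 1 \<Longrightarrow> s_quot g z \<noteq> s_quot extremal_F3 a"
    and a: "norm a = R"
  shows "class_radius G class_F3 = R"
proof (rule antisym)
  have "admissible_radius G class_F3 R"
    unfolding admissible_radius_def
  proof (intro conjI ballI allI impI)
    fix f r assume f: "f \<in> class_F3" and r: "0 < r \<and> r < R"
    have fA: "f \<in> class_A" using f by (simp add: class_F3_def)
    have r1: "0 < r" "r \<le> 1" using r R by auto
    have rz: "norm (of_real r * z) < R" if "z \<in> ball 0 1" for z :: complex
    proof -
      have "norm (of_real r * z) = r * norm z" using r by (simp add: norm_mult)
      also have "\<dots> \<le> r * 1"
        using that r by (intro mult_left_mono) auto
      also have "\<dots> < R" using r by simp
      finally show ?thesis .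
    qed
    show "(\<lambda>z. f (of_real r * z) / of_real r) \<in> G"
    proof (rule inner)
      show "(\<lambda>z. f (of_real r * z) / of_real r) \<in> class_A"
        by (rule dilation_class_A[OF fA r1])
      have "(\<lambda>z. s_quot f (of_real r * z)) holomorphic_on ball 0 1"
        using holomorphic_on_compose_gen[OF _ class_F3_s_quot(1)[OF f],
            of "\<lambda>z. of_real r * z" "ball 0 1"] rz R
        by (force simp: o_def intro!: holomorphic_intros)
      then show "s_quot (\<lambda>z. f (of_real r * z) / of_real r) holomorphic_on ball 0 1"
        by (rule holomorphic_transform) (simp add: dilation_class_A(2)[OF fA r1])
    next
      fix z :: complex assume "z \<in> ball 0 1"
      then show "\<exists>h\<in>class_F3. \<exists>w. norm w < R \<and>
          s_quot (\<lambda>z. f (of_real r * z) / of_real r) z = s_quot h w"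
        using f rz dilation_class_A(2)[OF fA r1] by blast
    qed
  qed (use R in auto)
  then show "R \<le> class_radius G class_F3"
    by (rule class_radius_greatest)
  show "class_radius G class_F3 \<le> R"
  proof (rule ccontr)
    assume "\<not> ?thesis"
    then obtain r where r: "R < r" "r < class_radius G class_F3"
      using dense by (metis not_le)
    have adm: "admissible_radius G class_F3 (class_radius G class_F3)"
      by (rule class_radius_greatest)
    then have r1: "0 < r" "r \<le> 1" using r R by (auto simp: admissible_radius_def)
    let ?g = "\<lambda>z. extremal_F3 (of_real r * z) / of_real r"
    have "?g \<in> G"
      using adm r r1 extremal_F3_in_class by (auto simp: admissible_radius_def)
    moreover have b: "a / of_real r \<in> ball 0 1"
      using a r R by (simp add: norm_divide)
    moreover have "s_quot ?g (a / of_real r) = s_quot extremal_F3 a"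
      using dilation_class_A(2)[OF _ r1 b, of extremal_F3] extremal_F3_in_class r1
      by (simp add: class_F3_def)
    ultimately show False using outer by blast
  qed
qed

lemma class_radius_F3_disc_min:
  assumes R: "0 < R" "R < 1" "disc_min R = \<alpha>"
    and inner: "\<And>g. \<lbrakk>g \<in> class_A; s_quot g holomorphic_on ball 0 1;
        \<And>z. z \<in> ball 0 1 \<Longrightarrow> norm (s_quot g z - 1) < 1 - \<alpha>\<rbrakk> \<Longrightarrow> g \<in> G"
    and outer: "\<And>g z. g \<in> G \<Longrightarrow> z \<in> ball 0 1 \<Longrightarrow> s_quot g z \<noteq> of_real \<alpha>"
  shows "class_radius G class_F3 = R"
proof (rule class_radius_F3_eq[OF R(1,2) inner])
  fix g and z :: complex
  assume "\<And>z. z \<in> ball 0 1 \<Longrightarrow> \<exists>f\<in>class_F3. \<exists>w. norm w < R \<and> s_quot g z = s_quot f w"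
    and "z \<in> ball 0 1"
  then obtain f w where "f \<in> class_F3" "norm w < R" "s_quot g z = s_quot f w" by blast
  then show "norm (s_quot g z - 1) < 1 - \<alpha>"
    using class_F3_s_quot_disc[of f w] disc_min_strict_antimono[of "norm w" R] R by simp
next
  fix g and z :: complex assume "g \<in> G" "z \<in> ball 0 1"
  then show "s_quot g z \<noteq> s_quot extremal_F3 (- of_real R)"
    using outer s_quot_extremal_F3_min[OF R(1,2)] R(3) by simp
qed (use R in auto)

text \<open>The class also demands univalence. As \<alpha> is nonnegative, the half-plane condition
  makes the real part of \<open>s_quot\<close> positive, and injectivity follows from that.\<close>

lemma starlike_order_radius:
  assumes "0 \<le> \<alpha>" and R: "0 < R" "R < 1" "disc_min R = \<alpha>"
  shows "class_radius (starlike_order \<alpha>) class_F3 = R"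
proof (rule class_radius_F3_disc_min[OF R])
  fix g assume g: "g \<in> class_A" "\<And>z. z \<in> ball 0 1 \<Longrightarrow> norm (s_quot g z - 1) < 1 - \<alpha>"
  have re: "Re (s_quot g z) > \<alpha>" if "z \<in> ball 0 1" for z
    using g(2)[OF that] abs_Re_le_cmod[of "s_quot g z - 1"] by simp
  moreover have "inj_on g (ball 0 1)"
    using starlike_imp_inj_on[OF g(1)] re assms(1) by fastforce
  ultimately show "g \<in> starlike_order \<alpha>"
    using g(1) by (simp add: starlike_order_def class_S_def)
qed (auto simp: starlike_order_def dest!: bspec)

subsection \<open>Subordination classes\<close>

text \<open>
  The set of values of \<open>norm \<circ> \<psi>\<close> on the ball is connected, contains 0 and omits 1.
\<close>
lemma right_inverse_norm_less_1:
  fixes \<phi> \<psi> :: "complex \<Rightarrow> complex"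
  assumes cont: "continuous_on (ball c \<delta>) \<psi>" and "\<psi> c = 0"
    and inv: "\<And>w. w \<in> ball c \<delta> \<Longrightarrow> \<phi> (\<psi> w) = w"
    and bd: "\<And>\<zeta>. norm \<zeta> = 1 \<Longrightarrow> norm (\<phi> \<zeta> - c) \<ge> \<delta>"
    and w: "w \<in> ball c \<delta>"
  shows "norm (\<psi> w) < 1"
proof (rule ccontr)
  assume n: "\<not> ?thesis"
  have "connected ((\<lambda>w. norm (\<psi> w)) ` ball c \<delta>)"
    by (intro connected_continuous_image continuous_on_norm cont convex_connected convex_ball)
  moreover have "c \<in> ball c \<delta>"
    using w by (metis centre_in_ball dist_not_less_zero linorder_not_less mem_ball order_le_less_trans)
  then have "0 \<in> (\<lambda>w. norm (\<psi> w)) ` ball c \<delta>"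
    using assms(2) by force
  moreover have "norm (\<psi> w) \<in> (\<lambda>w. norm (\<psi> w)) ` ball c \<delta>" using w by blast
  ultimately have "1 \<in> (\<lambda>w. norm (\<psi> w)) ` ball c \<delta>"
    using n connectedD_interval[of _ 0 "norm (\<psi> w)" 1] by auto
  then obtain v where v: "v \<in> ball c \<delta>" "norm (\<psi> v) = 1" by auto
  show False
    using bd[OF v(2)] inv[OF v(1)] v(1) by (simp add: dist_norm norm_minus_commute)
qed

lemma starlike_sub_E:
  assumes "g \<in> starlike_sub \<phi>" "z \<in> ball 0 1"
  obtains \<zeta> where "norm \<zeta> < 1" "s_quot g z = \<phi> \<zeta>"
  using assms by (fastforce simp: starlike_sub_def subordinate_def)

text \<open>The Schwarz function is \<open>\<psi>\<close> after \<open>s_quot g\<close>. The set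
  \<open>D\<close> is left arbitrary: it is a disc about 1 for most classes, but the right loop
  itself for the lemniscate.\<close>

lemma starlike_sub_I:
  assumes g: "g \<in> class_A" "s_quot g holomorphic_on ball 0 1"
    and "\<phi> holomorphic_on ball 0 1"
    and near: "\<And>z. z \<in> ball 0 1 \<Longrightarrow> s_quot g z \<in> D"
    and \<psi>: "\<psi> holomorphic_on D" "\<psi> 1 = 0"
    and norm: "\<And>w. w \<in> D \<Longrightarrow> norm (\<psi> w) < 1"
    and inv: "\<And>w. w \<in> D \<Longrightarrow> \<phi> (\<psi> w) = w"
  shows "g \<in> starlike_sub \<phi>"
proof -
  have "(\<lambda>z. \<psi> (s_quot g z)) holomorphic_on ball 0 1"
    using holomorphic_on_compose_gen[OF g(2) \<psi>(1)] near by (force simp: o_def)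
  moreover have "(\<lambda>z. \<psi> (s_quot g z)) ` ball 0 1 \<subseteq> ball 0 1"
    using norm near by auto
  moreover have "\<psi> (s_quot g 0) = 0"
    using \<psi>(2) by (simp add: s_quot_def)
  moreover have "\<forall>z\<in>ball 0 1. s_quot g z = \<phi> (\<psi> (s_quot g z))"
    using inv near by simp
  ultimately show ?thesis
    using assms(1-3) by (auto simp: starlike_sub_def subordinate_def
        intro!: exI[of _ "\<lambda>z. \<psi> (s_quot g z)"])
qed

lemma starlike_sub_radius:
  assumes R: "0 < R" "R < 1" "disc_min R = \<alpha>"
    and hol: "\<phi> holomorphic_on ball 0 1"
    and \<psi>: "\<psi> holomorphic_on ball 1 (1 - \<alpha>)" "\<psi> 1 = 0"
    and norm: "\<And>w. w \<in> ball 1 (1 - \<alpha>) \<Longrightarrow> norm (\<psi> w) < 1"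
    and inv: "\<And>w. w \<in> ball 1 (1 - \<alpha>) \<Longrightarrow> \<phi> (\<psi> w) = w"
    and omit: "\<And>\<zeta>. norm \<zeta> < 1 \<Longrightarrow> \<phi> \<zeta> \<noteq> of_real \<alpha>"
  shows "class_radius (starlike_sub \<phi>) class_F3 = R"
proof (rule class_radius_F3_disc_min[OF R])
  fix g assume "g \<in> class_A" "s_quot g holomorphic_on ball 0 1"
    "\<And>z. z \<in> ball 0 1 \<Longrightarrow> norm (s_quot g z - 1) < 1 - \<alpha>"
  then show "g \<in> starlike_sub \<phi>"
    by (intro starlike_sub_I[OF _ _ hol _ \<psi> norm inv])
      (auto simp: dist_norm norm_minus_commute)
next
  fix g and z :: complex assume "g \<in> starlike_sub \<phi>" "z \<in> ball 0 1"
  then show "s_quot g z \<noteq> of_real \<alpha>"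
    using omit by (metis starlike_sub_E)
qed

section \<open>The exponential and the sine\<close>

lemma Re_pos_of_ball: "w \<in> ball 1 \<delta> \<Longrightarrow> \<delta> \<le> 1 \<Longrightarrow> Re w > 0" for w :: complex
  using abs_Re_le_cmod[of "1 - w"] by (simp add: dist_norm)

text \<open>The power series of -ln (1 - t) has as coefficients the moduli of those of Ln (1 + u),
  so it majorises the latter termwise at t = |u|. The majorant is below 1 precisely for t < 1 - 1/e,
  which is the radius of the disc for the exponential class.\<close>

lemma norm_Ln_one_plus_le:
  assumes "norm u < 1"
  shows "norm (Ln (1 + u)) \<le> - ln (1 - norm u)"
proof -
  have 1: "(\<lambda>n. - ((-u)^n) / of_nat n) sums ln (1 + u)"
    using assms by (rule Ln_series')
  have "(\<lambda>n. - ((- (- norm u))^n) / of_nat n) sums ln (1 + - norm u)"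
    using assms by (intro ln_series') simp
  then have 2: "(\<lambda>n. norm u ^ n / of_nat n) sums - ln (1 - norm u)"
    using sums_minus by fastforce
  have "norm (\<Sum>n. - ((-u)^n) / of_nat n) \<le> (\<Sum>n. norm u ^ n / of_nat n)"
    using sums_summable[OF 2] by (intro norm_suminf_le) (auto simp: norm_divide norm_power)
  then show ?thesis
    using sums_unique[OF 1] sums_unique[OF 2] by simp
qed

lemma starlike_e_radius:
  assumes R: "0 < R" "R < 1" "disc_min R = 1 / exp 1"
  shows "class_radius starlike_e class_F3 = R"
proof (rule starlike_sub_radius[OF R, where \<psi> = Ln])
  have re: "w \<notin> \<real>\<^sub>\<le>\<^sub>0" if "w \<in> ball 1 (1 - 1 / exp 1)" for w :: complex
    using Re_pos_of_ball[OF that] by (auto simp: complex_nonpos_Reals_iff)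
  show "Ln holomorphic_on ball 1 (1 - 1 / exp 1)"
    using re by (intro holomorphic_intros) auto
  fix w :: complex assume w: "w \<in> ball 1 (1 - 1 / exp 1)"
  show "exp (Ln w) = w" using re[OF w] by (intro exp_Ln) auto
  have d: "norm (w - 1) < 1 - exp (-1)"
    using w by (simp add: dist_norm norm_minus_commute exp_minus inverse_eq_divide)
  then have "norm (w - 1) < 1" using exp_gt_zero[of "-1 :: real"] by linarith
  moreover from this have "ln (exp (-1)) < ln (1 - norm (w - 1))"
    using d \<open>norm (w - 1) < 1\<close> by (subst ln_less_cancel_iff) auto
  ultimately show "norm (Ln w) < 1"
    using norm_Ln_one_plus_le[of "w - 1"] by simp
next
  fix \<zeta> :: complex assume z: "norm \<zeta> < 1"
  show "exp \<zeta> \<noteq> of_real (1 / exp 1)"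
  proof
    assume "exp \<zeta> = of_real (1 / exp 1)"
    then have "norm (exp \<zeta>) = exp (-1)"
      by (simp add: exp_minus inverse_eq_divide norm_divide)
    then show False using abs_Re_le_cmod[of \<zeta>] z by simp
  qed
qed (auto intro!: holomorphic_intros)

text \<open>|sin (x + i y)|^2 = (sin x)^2 + (sinh y)^2, and |sinh y| \<ge> |y|. On the unit circle
  y^2 = 1 - x^2, so it remains to see that x^2 - (sin x)^2 increases on [0, 1]; its derivative is 2x
  - sin 2x.\<close>

lemma norm_sin_ge_sin_1:
  fixes \<zeta> :: complex
  assumes "norm \<zeta> = 1"
  shows "norm (sin \<zeta>) \<ge> sin 1"
proof -
  define x y where "x = \<bar>Re \<zeta>\<bar>" and "y = Im \<zeta>"
  have xy: "x\<^sup>2 + y\<^sup>2 = 1"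
    using assms cmod_power2[of \<zeta>] by (simp add: x_def y_def)
  have x: "0 \<le> x" "x \<le> 1"
    using abs_Re_le_cmod[of \<zeta>] assms by (auto simp: x_def)
  have "\<exists>z. z > x \<and> z < 1 \<and> (1\<^sup>2 - (sin 1)\<^sup>2) - (x\<^sup>2 - (sin x)\<^sup>2) = (1 - x) * (2 * z - sin (2 * z))"
    if "x < 1"
    by (rule MVT2[OF that]) (auto intro!: derivative_eq_intros simp: sin_double)
  moreover have "0 \<le> (1 - x) * (2 * z - sin (2 * z))" if "z > x" for z :: real
    using x that sin_x_le_x[of "2 * z"] by simp
  ultimately have "x\<^sup>2 - (sin x)\<^sup>2 \<le> 1 - (sin 1)\<^sup>2" if "x < 1"
    using that by fastforce
  then have "x\<^sup>2 - (sin x)\<^sup>2 \<le> 1 - (sin 1)\<^sup>2"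
    using x by (cases "x < 1") auto
  moreover have "(2 + (2 * y)\<^sup>2) \<le> exp (2 * y) + exp (- (2 * y))"
  proof -
    have "cosh (2 * y) = 1 + 2 * (sinh y)\<^sup>2"
      by (simp add: cosh_double cosh_square_eq)
    moreover have "sinh 0 - 0 \<le> sinh \<bar>y\<bar> - \<bar>y\<bar>"
      by (rule DERIV_nonneg_imp_nondecreasing)
        (auto intro!: derivative_eq_intros exI cosh_real_ge_1)
    then have "\<bar>y\<bar> \<le> \<bar>sinh y\<bar>"
      by (simp add: abs_if split: if_splits)
    then have "y\<^sup>2 \<le> (sinh y)\<^sup>2" by (simp add: abs_le_square_iff)
    ultimately show ?thesis by (simp add: cosh_def power2_eq_square)
  qed
  moreover have "(norm (sin \<zeta>))\<^sup>2 = (exp (2 * y) + exp (- (2 * y)) - 2 * cos (2 * x)) / 4"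
    unfolding norm_sin_squared by (simp add: x_def y_def exp_minus abs_if)
  moreover have "cos (2 * x) = 1 - 2 * (sin x)\<^sup>2"
    by (rule cos_double_sin)
  ultimately have "(sin 1)\<^sup>2 \<le> (norm (sin \<zeta>))\<^sup>2"
    using xy by (simp add: power2_eq_square)
  then show ?thesis by (rule power2_le_imp_le) simp
qed

lemma starlike_sin_radius:
  assumes R: "0 < R" "R < 1" "disc_min R = 1 - sin 1"
  shows "class_radius starlike_sin class_F3 = R"
proof (rule starlike_sub_radius[OF R, where \<psi> = "\<lambda>w. Arcsin (w - 1)"])
  show hol: "(\<lambda>w. Arcsin (w - 1)) holomorphic_on ball 1 (1 - (1 - sin 1))"
  proof -
    have "\<bar>Re (w - 1)\<bar> < 1" if "w \<in> ball 1 (1 - (1 - sin 1))" for w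
    proof -
      have "norm (w - 1) < sin 1" using that by (simp add: dist_norm norm_minus_commute)
      then show ?thesis using abs_Re_le_cmod[of "w - 1"] sin_le_one[of "1::real"] by linarith
    qed
    then have "Arcsin holomorphic_on (\<lambda>w. w - 1) ` ball 1 (1 - (1 - sin 1))"
      by (intro holomorphic_on_Arcsin) auto
    then show ?thesis
      using holomorphic_on_compose[of "\<lambda>w. w - 1" "ball 1 (1 - (1 - sin 1))" Arcsin]
      by (simp add: o_def holomorphic_intros)
  qed
  show inv: "phi_sin (Arcsin (w - 1)) = w" for w
    by (simp add: phi_sin_def)
  show "norm (Arcsin (w - 1)) < 1" if "w \<in> ball 1 (1 - (1 - sin 1))" for w
    using holomorphic_on_imp_continuous_on[OF hol] that norm_sin_ge_sin_1
    by (intro right_inverse_norm_less_1[where \<psi> = "\<lambda>w. Arcsin (w - 1)" and \<phi> = phi_sin, OF _ _ inv])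
      (auto simp: phi_sin_def)
next
  fix \<zeta> :: complex assume z: "norm \<zeta> < 1"
  show "phi_sin \<zeta> \<noteq> of_real (1 - sin 1)"
  proof
    assume "phi_sin \<zeta> = of_real (1 - sin 1)"
    then have "sin \<zeta> = sin (-1)" by (simp add: phi_sin_def flip: sin_of_real)
    \<comment> \<open>\<open>Arcsin\<close> inverts the sine on the strip |Re| < pi/2, which
      contains the unit disc and -1; hence sin \<zeta> = sin (-1) would force \<zeta> = -1.\<close>
    moreover have "Arcsin (sin \<zeta>) = \<zeta>"
      using z abs_Re_le_cmod[of \<zeta>] pi_gt3 by (intro Arcsin_sin) auto
    moreover have "Arcsin (sin (-1)) = (-1 :: complex)"
      by (rule Arcsin_sin) (use pi_gt3 in simp)
    ultimately show False using z by simp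
  qed
qed (auto simp: phi_sin_def[abs_def] intro!: holomorphic_intros)

section \<open>The lune, the cardioid and the rational function\<close>

lemma one_plus_square_not_nonpos_Real: "1 + z\<^sup>2 \<notin> \<real>\<^sub>\<le>\<^sub>0" if "norm z < 1" for z :: complex
proof -
  have "norm (z\<^sup>2) < 1" using that by (simp add: norm_power real_sq_less_1)
  then have "Re (1 + z\<^sup>2) > 0" using abs_Re_le_cmod[of "z\<^sup>2"] by simp
  then show ?thesis by (auto simp: complex_nonpos_Reals_iff)
qed

text \<open>Squaring w - z = csqrt (1 + z^2) leaves w^2 - 2wz = 1, which gives
  \<open>\<psi>\<close>. The root is the principal one since (w + 1/w)/2 has positive real part
  together with w.\<close>

lemma starlike_lune_radius:
  assumes R: "0 < R" "R < 1" "disc_min R = sqrt 2 - 1"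
  shows "class_radius starlike_lune class_F3 = R"
proof (rule starlike_sub_radius[OF R, where \<psi> = "\<lambda>w. (w\<^sup>2 - 1) / (2 * w)"])
  have s2: "sqrt 2 * sqrt 2 = (2::real)" "1 < sqrt 2" "sqrt 2 < 2"
    by (auto intro: real_less_rsqrt real_less_lsqrt)
  have re: "Re w > 0" if "w \<in> ball 1 (1 - (sqrt 2 - 1))" for w :: complex
    using Re_pos_of_ball[OF that] s2 by simp
  then have nz: "w \<noteq> 0" if "w \<in> ball 1 (1 - (sqrt 2 - 1))" for w :: complex
    using that by force
  then show "(\<lambda>w. (w\<^sup>2 - 1) / (2 * w)) holomorphic_on ball 1 (1 - (sqrt 2 - 1))"
    by (intro holomorphic_intros) auto
  fix w :: complex assume w: "w \<in> ball 1 (1 - (sqrt 2 - 1))"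
  have "csqrt (1 + ((w\<^sup>2 - 1) / (2 * w))\<^sup>2) = (w\<^sup>2 + 1) / (2 * w)"
  proof (rule csqrt_unique)
    show "((w\<^sup>2 + 1) / (2 * w))\<^sup>2 = 1 + ((w\<^sup>2 - 1) / (2 * w))\<^sup>2"
      using nz[OF w] by (simp add: power2_eq_square field_simps)
    have "(w\<^sup>2 + 1) / (2 * w) = (w + 1 / w) / 2"
      using nz[OF w] by (simp add: power2_eq_square field_simps)
    also have "Re \<dots> > 0"
      using re[OF w] nz[OF w] by (simp add: Re_divide' add_pos_pos)
    finally show "0 < Re ((w\<^sup>2 + 1) / (2 * w)) \<or>
      Re ((w\<^sup>2 + 1) / (2 * w)) = 0 \<and> 0 \<le> Im ((w\<^sup>2 + 1) / (2 * w))" by simp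
  qed
  then show "phi_lune ((w\<^sup>2 - 1) / (2 * w)) = w"
    using nz[OF w] by (simp add: phi_lune_def power2_eq_square field_simps)
  have d: "norm (w - 1) < 2 - sqrt 2"
    using w by (simp add: dist_norm norm_minus_commute)
  have "norm (w + 1) \<ge> 2 - norm (w - 1)"
    using norm_triangle_ineq2[of 2 "1 - w"] by (simp add: norm_minus_commute add.commute)
  then have "sqrt 2 < norm (w + 1)" using d by simp
  then have "(sqrt 2)\<^sup>2 < (norm (w + 1))\<^sup>2"
    by (intro power_strict_mono) auto
  then have 1: "2 < (Re w + 1)\<^sup>2 + (Im w)\<^sup>2" unfolding cmod_power2 by simp
  have "norm (w - 1) < sqrt 2" using d s2 by linarith
  then have "(norm (w - 1))\<^sup>2 < (sqrt 2)\<^sup>2"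
    by (intro power_strict_mono) auto
  then have 2: "(Re w - 1)\<^sup>2 + (Im w)\<^sup>2 < 2" unfolding cmod_power2 by simp
  \<comment> \<open>The region |w^2 - 1| < 2|w| in the right half-plane is the lune inside the
    circle of radius sqrt 2 about 1 and outside the one about -1; this factorisation expresses
    it.\<close>
  have "0 < ((Re w + 1)\<^sup>2 + (Im w)\<^sup>2 - 2) * (2 - ((Re w - 1)\<^sup>2 + (Im w)\<^sup>2))"
    using 1 2 by simp
  also have "\<dots> = (norm (2 * w))\<^sup>2 - (norm (w\<^sup>2 - 1))\<^sup>2"
    unfolding cmod_power2 by (simp add: power2_eq_square algebra_simps)
  finally have "norm (w\<^sup>2 - 1) < norm (2 * w)"
    using power2_less_imp_less[of "norm (w\<^sup>2 - 1)" "norm (2 * w)"] by simp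
  then show "norm ((w\<^sup>2 - 1) / (2 * w)) < 1"
    using nz[OF w] by (simp add: norm_divide)
next
  fix \<zeta> :: complex assume z: "norm \<zeta> < 1"
  show "phi_lune \<zeta> \<noteq> of_real (sqrt 2 - 1)"
  proof
    define a where "a = complex_of_real (sqrt 2 - 1)"
    assume "phi_lune \<zeta> = of_real (sqrt 2 - 1)"
    then have "csqrt (1 + \<zeta>\<^sup>2) = a - \<zeta>"
      by (simp add: phi_lune_def a_def algebra_simps)
    then have "1 + \<zeta>\<^sup>2 = (a - \<zeta>)\<^sup>2" by (metis power2_csqrt)
    then have "2 * a * \<zeta> = a\<^sup>2 - 1"
      by (simp add: power2_eq_square algebra_simps)
    also have "a\<^sup>2 - 1 = of_real ((sqrt 2 - 1)\<^sup>2 - 1)" by (simp add: a_def)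
    also have "(sqrt 2 - 1)\<^sup>2 - 1 = - 2 * (sqrt 2 - 1)"
      by (simp add: power2_eq_square algebra_simps)
    also have "of_real (- 2 * (sqrt 2 - 1)) = 2 * a * (-1)" by (simp add: a_def)
    finally have "a = 0 \<or> \<zeta> = -1" by (simp only: mult_cancel_left) simp
    moreover have "a \<noteq> 0" unfolding a_def of_real_eq_0_iff by simp
    ultimately show False using z by simp
  qed
qed (use one_plus_square_not_nonpos_Real in \<open>auto simp: phi_lune_def[abs_def] intro!: holomorphic_intros\<close>)

text \<open>Completing the square, phi_C z = 1/3 + 2/3 (z + 1)^2. This gives the inverse, places its
  branch point 1/3 on the boundary of the disc, and shows that 1/3 is attained only at -1.\<close>

lemma starlike_C_radius:
  assumes R: "0 < R" "R < 1" "disc_min R = 1 / 3"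
  shows "class_radius starlike_C class_F3 = R"
proof (rule starlike_sub_radius[OF R, where \<psi> = "\<lambda>w. csqrt (1 + 3 / 2 * (w - 1)) - 1"])
  show hol: "(\<lambda>w. csqrt (1 + 3 / 2 * (w - 1)) - 1) holomorphic_on ball 1 (1 - 1 / 3)"
  proof (intro holomorphic_intros)
    fix w :: complex assume "w \<in> ball 1 (1 - 1 / 3)"
    then have "Re w > 1 / 3"
      using abs_Re_le_cmod[of "1 - w"] by (simp add: dist_norm)
    then have "Re (1 + 3 / 2 * (w - 1)) > 0" by (simp add: field_simps)
    then show "1 + 3 / 2 * (w - 1) \<notin> \<real>\<^sub>\<le>\<^sub>0" by (auto simp: complex_nonpos_Reals_iff)
  qed
  show inv: "phi_C (csqrt (1 + 3 / 2 * (w - 1)) - 1) = w" for w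
  proof -
    have "phi_C (t - 1) = 1 + 2 / 3 * (t\<^sup>2 - 1)" for t :: complex
      by (simp add: phi_C_def power2_eq_square field_simps)
    from this[of "csqrt (1 + 3 / 2 * (w - 1))"]
    have "phi_C (csqrt (1 + 3 / 2 * (w - 1)) - 1) = 1 + 2 / 3 * (3 / 2 * (w - 1))"
      by (simp only: power2_csqrt add_diff_cancel_left')
    also have "\<dots> = w" by (simp add: field_simps)
    finally show ?thesis .
  qed
  have "2 / 3 \<le> norm (phi_C \<zeta> - 1)" if "norm \<zeta> = 1" for \<zeta>
  proof -
    have "phi_C \<zeta> - 1 = 2 / 3 * \<zeta> * (2 + \<zeta>)"
      by (simp add: phi_C_def power2_eq_square algebra_simps)
    also have "norm (2 / 3 * \<zeta> * (2 + \<zeta>)) = 2 / 3 * norm (2 + \<zeta>)"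
      using that by (simp add: norm_mult norm_divide)
    finally have "norm (phi_C \<zeta> - 1) = 2 / 3 * norm (2 + \<zeta>)" .
    then show ?thesis using norm_two_plus[of \<zeta>] that by simp
  qed
  then show "norm (csqrt (1 + 3 / 2 * (w - 1)) - 1) < 1" if "w \<in> ball 1 (1 - 1 / 3)" for w
    using holomorphic_on_imp_continuous_on[OF hol] that
    by (intro right_inverse_norm_less_1[where \<psi> = "\<lambda>w. csqrt (1 + 3 / 2 * (w - 1)) - 1"
          and \<phi> = phi_C, OF _ _ inv]) auto
next
  fix \<zeta> :: complex assume z: "norm \<zeta> < 1"
  show "phi_C \<zeta> \<noteq> of_real (1 / 3)"
  proof
    have "(\<zeta> + 1)\<^sup>2 = 3 / 2 * (phi_C \<zeta> - of_real (1 / 3))"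
      by (simp add: phi_C_def power2_eq_square field_simps)
    also assume "phi_C \<zeta> = of_real (1 / 3)"
    finally have "(\<zeta> + 1)\<^sup>2 = 0" by simp
    then show False using z by (simp add: add_eq_0_iff2)
  qed
qed (auto simp: phi_C_def[abs_def] intro!: holomorphic_intros)

lemma starlike_R_radius:
  assumes R: "0 < R" "R < 1" "disc_min R = 2 * (sqrt 2 - 1)"
  shows "class_radius starlike_R class_F3 = R"
proof -
  define k where "k = sqrt 2 + 1"
  \<comment> \<open>With \<open>u = w - 1\<close>, the equation \<open>phi_R z = w\<close> is quadratic in \<open>z\<close> with discriminant
    \<open>k\<^sup>2 (1 + 6 u + u\<^sup>2)\<close>; it is split as \<open>(1 + k\<^sup>2 u) (1 + u / k\<^sup>2)\<close> because both factors have
    positive real part.\<close>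
  define \<psi> where "\<psi> w = of_real k / 2 * (csqrt (1 + of_real k ^ 2 * (w - 1))
    * csqrt (1 + (w - 1) / of_real k ^ 2) - w)" for w
  have k1: "1 < k" by (simp add: k_def)
  have kk: "k\<^sup>2 = 2 * k + 1"
    by (simp add: k_def power2_eq_square algebra_simps)
  have \<delta>: "1 - 2 * (sqrt 2 - 1) = 1 / k\<^sup>2"
  proof -
    have "(1 - 2 * (sqrt 2 - 1)) * k\<^sup>2 = 1"
      by (simp add: k_def power2_eq_square algebra_simps)
    then show ?thesis using k1 by (simp add: eq_divide_eq)
  qed
  have phi: "phi_R \<zeta> = 1 + \<zeta> * (k + \<zeta>) / (k * (k - \<zeta>))" for \<zeta> :: complex
    unfolding phi_R_def Let_def k_def[symmetric] by (simp add: power2_eq_square algebra_simps)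
  show ?thesis
  proof (rule starlike_sub_radius[OF R, where \<psi> = \<psi>, unfolded \<delta>])
    have re1: "Re (1 + of_real k ^ 2 * (w - 1)) > 0" and re2: "Re (1 + (w - 1) / of_real k ^ 2) > 0"
      if "w \<in> ball 1 (1 / k\<^sup>2)" for w
    proof -
      have "norm (w - 1) < 1 / k\<^sup>2" using that by (simp add: dist_norm norm_minus_commute)
      then have "\<bar>Re w - 1\<bar> < 1 / k\<^sup>2" using abs_Re_le_cmod[of "w - 1"] by simp
      then have w: "k\<^sup>2 * \<bar>Re w - 1\<bar> < 1" using k1 by (simp add: field_simps)
      have k2: "1 < k\<^sup>2" using k1 kk by simp
      show "Re (1 + of_real k ^ 2 * (w - 1)) > 0"
      proof -
        have "- (k\<^sup>2 * \<bar>Re w - 1\<bar>) \<le> k\<^sup>2 * (Re w - 1)"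
          using mult_left_mono[of "- \<bar>Re w - 1\<bar>" "Re w - 1" "k\<^sup>2"] by simp
        then show ?thesis using w by (simp flip: of_real_power)
      qed
      show "Re (1 + (w - 1) / of_real k ^ 2) > 0"
      proof -
        have "1 * \<bar>Re w - 1\<bar> \<le> k\<^sup>2 * \<bar>Re w - 1\<bar>"
          using k2 by (intro mult_right_mono) auto
        then have "\<bar>Re w - 1\<bar> < k\<^sup>2" using w k2 by simp
        then have "\<bar>(Re w - 1) / k\<^sup>2\<bar> < 1" using k2 by (simp add: abs_divide divide_less_eq)
        then have "- 1 < (Re w - 1) / k\<^sup>2" by linarith
        then show ?thesis by (simp flip: of_real_power)
      qed
    qed
    show hol: "\<psi> holomorphic_on ball 1 (1 / k\<^sup>2)"
      unfolding \<psi>_def using re1 re2 k1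
      by (intro holomorphic_intros) (force simp: complex_nonpos_Reals_iff)+
    show psi1: "\<psi> 1 = 0" by (simp add: \<psi>_def)
    show inv: "phi_R (\<psi> w) = w" for w
    proof -
      define K where "K = complex_of_real k"
      define q where "q = csqrt (1 + K ^ 2 * (w - 1)) * csqrt (1 + (w - 1) / K ^ 2)"
      define z where "z = \<psi> w"
      have K0: "K \<noteq> 0" using k1 by (simp add: K_def)
      have KK: "K\<^sup>2 = 2 * K + 1" unfolding K_def using arg_cong[OF kk, of complex_of_real] by simp
      have "2 * z + K * w = K * q"
        by (simp add: z_def \<psi>_def q_def K_def algebra_simps)
      then have "(2 * z + K * w)\<^sup>2 = K\<^sup>2 * ((1 + K ^ 2 * (w - 1)) * (1 + (w - 1) / K ^ 2))"
        by (simp add: q_def power_mult_distrib)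
      also have "\<dots> = (1 + K ^ 2 * (w - 1)) * (K\<^sup>2 + (w - 1))"
        using K0 by (simp add: field_simps)
      also have "\<dots> = K\<^sup>2 * w\<^sup>2 + 4 * K\<^sup>2 * (w - 1)"
      proof -
        \<comment> \<open>This is k^2 + 1/k^2 = 6, the reason why the split product equals 1 + 6u +
          u^2.\<close>
        have "K ^ 4 - 6 * K\<^sup>2 + 1 = (K\<^sup>2 - (2 * K + 1)) * (K\<^sup>2 + 2 * K - 1)"
          by (simp add: power2_eq_square power4_eq_xxxx algebra_simps)
        then have "K ^ 4 - 6 * K\<^sup>2 + 1 = 0" using KK by simp
        moreover have "(1 + K ^ 2 * (w - 1)) * (K\<^sup>2 + (w - 1))
            = K\<^sup>2 * w\<^sup>2 + 4 * K\<^sup>2 * (w - 1) + (K ^ 4 - 6 * K\<^sup>2 + 1) * (w - 1)"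
          by (simp add: power2_eq_square power4_eq_xxxx algebra_simps)
        ultimately show ?thesis by simp
      qed
      finally have "(2 * z + K * w)\<^sup>2 - K\<^sup>2 * w\<^sup>2 = 4 * (K\<^sup>2 * (w - 1))" by simp
      moreover have "(2 * z + K * w)\<^sup>2 - K\<^sup>2 * w\<^sup>2 = 4 * (z\<^sup>2 + K * w * z)"
        by (simp add: power2_eq_square algebra_simps)
      ultimately have "4 * (z\<^sup>2 + K * w * z) = 4 * (K\<^sup>2 * (w - 1))" by (simp only:)
      then have q: "z\<^sup>2 + K * w * z = K\<^sup>2 * (w - 1)"
        by (simp only: mult_cancel_left) simp
      \<comment> \<open>With z = K the quadratic equation would become 2 K^2 = 0.\<close>
      have "K - z \<noteq> 0"
        using q K0 by (auto simp: power2_eq_square algebra_simps)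
      moreover have "z * (K + z) = (w - 1) * (K * (K - z))"
        using q by (simp add: power2_eq_square algebra_simps)
      ultimately show ?thesis
        using K0 by (simp add: phi z_def[symmetric] K_def[symmetric])
    qed
    have "1 / k\<^sup>2 \<le> norm (phi_R \<zeta> - 1)" if z: "norm \<zeta> = 1" for \<zeta>
    proof -
      \<comment> \<open>Both estimates are equalities at \<zeta> = -1, and k (k - 1) = k + 1 turns
        the resulting bound into exactly 1/k^2.\<close>
      have "k - 1 \<le> norm (k + \<zeta>)"
        using norm_triangle_ineq2[of "of_real k" "-\<zeta>"] z k1 by simp
      moreover have "norm (k - \<zeta>) \<le> k + 1"
        using norm_triangle_ineq4[of "of_real k" "\<zeta>"] z k1 by simp
      moreover have "norm (k - \<zeta>) > 0" using z k1 by auto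
      ultimately have "(k - 1) / (k * (k + 1)) \<le> norm (k + \<zeta>) / (k * norm (k - \<zeta>))"
        using k1 by (intro frac_le mult_left_mono mult_pos_pos) auto
      also have "(k - 1) / (k * (k + 1)) = 1 / k\<^sup>2"
        using k1 kk by (simp add: divide_simps) (simp add: algebra_simps power2_eq_square)
      also have "norm (k + \<zeta>) / (k * norm (k - \<zeta>)) = norm (phi_R \<zeta> - 1)"
        using z k1 by (simp add: phi norm_mult norm_divide)
      finally show ?thesis .
    qed
    then show "norm (\<psi> w) < 1" if "w \<in> ball 1 (1 / k\<^sup>2)" for w
      using right_inverse_norm_less_1[OF holomorphic_on_imp_continuous_on[OF hol] psi1 inv] that
      by blast
    show "phi_R holomorphic_on ball 0 1"
      unfolding phi[abs_def] using k1 by (intro holomorphic_intros) auto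
    fix \<zeta> :: complex assume z: "norm \<zeta> < 1"
    show "phi_R \<zeta> \<noteq> of_real (2 * (sqrt 2 - 1))"
    proof
      define K where "K = complex_of_real k"
      have K0: "K \<noteq> 0" "K - \<zeta> \<noteq> 0" using k1 z by (auto simp: K_def)
      have KK: "K\<^sup>2 = 2 * K + 1" unfolding K_def using arg_cong[OF kk, of complex_of_real] by simp
      assume "phi_R \<zeta> = of_real (2 * (sqrt 2 - 1))"
      also have "2 * (sqrt 2 - 1) = 1 - 1 / k\<^sup>2" using \<delta> by simp
      finally have E: "\<zeta> * (K + \<zeta>) / (K * (K - \<zeta>)) = - (1 / K\<^sup>2)"
        by (simp add: phi K_def)
      have "K * (\<zeta> * (K + \<zeta>)) + (K - \<zeta>) = 0"
      proof -
        have "\<zeta> * (K + \<zeta>) = \<zeta> * (K + \<zeta>) / (K * (K - \<zeta>)) * (K * (K - \<zeta>))"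
          using K0 by simp
        also have "\<dots> = - (1 / K\<^sup>2) * (K * (K - \<zeta>))" by (simp only: E)
        finally have "\<zeta> * (K + \<zeta>) = - (1 / K\<^sup>2) * (K * (K - \<zeta>))" .
        then have "K * (\<zeta> * (K + \<zeta>)) = K * (- (1 / K\<^sup>2) * (K * (K - \<zeta>)))" by simp
        also have "\<dots> = - (K - \<zeta>)" using K0 by (simp add: power2_eq_square)
        finally show ?thesis by simp
      qed
      \<comment> \<open>Because K^2 = 2K + 1, the cleared equation is a perfect square: -1 is a
        double solution, outside the open disc.\<close>
      moreover have "K * (\<zeta> + 1)\<^sup>2 = K * (\<zeta> * (K + \<zeta>)) + (K - \<zeta>) - (K\<^sup>2 - (2 * K + 1)) * \<zeta>"
        by (simp add: power2_eq_square algebra_simps)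
      ultimately have "K * (\<zeta> + 1)\<^sup>2 = 0" using KK by simp
      then show False using K0 z by (simp add: add_eq_0_iff2)
    qed
  qed
qed

section \<open>The parabolic class\<close>

text \<open>Near the cut of \<open>csqrt\<close> the root i csqrt (-z) is holomorphic, and evenness
  makes \<open>F\<close> agree on the two roots. The slit domains cover all of \<open>S\<close>
  except 0, where continuity of \<open>csqrt\<close> makes the singularity removable.\<close>

lemma holomorphic_even_csqrt:
  assumes S: "open S" and holF: "F holomorphic_on {s. s\<^sup>2 \<in> S}"
    and even: "\<And>s. s\<^sup>2 \<in> S \<Longrightarrow> F (- s) = F s"
  shows "(\<lambda>z. F (csqrt z)) holomorphic_on S"
proof -
  have flip: "F (csqrt z) = F (\<i> * csqrt (- z))" if "z \<in> S" for z
  proof -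
    have "(\<i> * csqrt (- z))\<^sup>2 = (csqrt z)\<^sup>2" by (simp add: power_mult_distrib)
    then have "\<i> * csqrt (- z) = csqrt z \<or> \<i> * csqrt (- z) = - csqrt z"
      by (simp only: power2_eq_iff)
    then show ?thesis using even[of "csqrt z"] that by auto
  qed
  have "csqrt holomorphic_on S \<inter> - \<real>\<^sub>\<le>\<^sub>0"
    by (rule holomorphic_on_subset[OF holomorphic_on_csqrt]) auto
  then have 1: "(\<lambda>z. F (csqrt z)) holomorphic_on S \<inter> - \<real>\<^sub>\<le>\<^sub>0"
    using holomorphic_on_compose_gen[OF _ holF, of csqrt "S \<inter> - \<real>\<^sub>\<le>\<^sub>0"]
    by (force simp: o_def)
  have "(\<lambda>z. \<i> * csqrt (- z)) holomorphic_on S \<inter> uminus -` (- \<real>\<^sub>\<le>\<^sub>0)"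
    by (intro holomorphic_intros) auto
  then have "(\<lambda>z. F (\<i> * csqrt (- z))) holomorphic_on S \<inter> uminus -` (- \<real>\<^sub>\<le>\<^sub>0)"
    using holomorphic_on_compose_gen[OF _ holF, of "\<lambda>z. \<i> * csqrt (- z)" "S \<inter> uminus -` (- \<real>\<^sub>\<le>\<^sub>0)"]
    by (force simp: o_def power_mult_distrib)
  then have 2: "(\<lambda>z. F (csqrt z)) holomorphic_on S \<inter> uminus -` (- \<real>\<^sub>\<le>\<^sub>0)"
    by (rule holomorphic_transform) (auto simp: flip)
  have op: "open (S \<inter> - \<real>\<^sub>\<le>\<^sub>0)" "open (S \<inter> uminus -` (- \<real>\<^sub>\<le>\<^sub>0))"
    using S by (auto intro!: open_Int open_vimage continuous_intros)
  have "(\<lambda>z. F (csqrt z)) holomorphic_on (S \<inter> - \<real>\<^sub>\<le>\<^sub>0) \<union> (S \<inter> uminus -` (- \<real>\<^sub>\<le>\<^sub>0))"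
    by (rule holomorphic_on_Un[OF 1 2 op])
  moreover have "(S \<inter> - \<real>\<^sub>\<le>\<^sub>0) \<union> (S \<inter> uminus -` (- \<real>\<^sub>\<le>\<^sub>0)) = S - {0}"
    by (auto simp: complex_nonpos_Reals_iff complex_eq_iff)
  ultimately have hol0: "(\<lambda>z. F (csqrt z)) holomorphic_on S - {0}" by simp
  show ?thesis
  proof (rule no_isolated_singularity[OF _ hol0 S])
    have "isCont (\<lambda>z. F (csqrt z)) z" if z: "z \<in> S" for z
    proof (cases "z = 0")
      case False
      then show ?thesis
        using z hol0 S by (meson DiffI continuous_on_eq_continuous_at finite.emptyI finite_insert
            holomorphic_on_imp_continuous_on open_Diff finite_imp_closed singletonD)
    next
      case True
      have "open {s::complex. s\<^sup>2 \<in> S}"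
        using open_vimage[OF S, of "\<lambda>s. s\<^sup>2"] by (simp add: vimage_def continuous_intros)
      then have F: "isCont F (csqrt 0)"
        using holF z True continuous_on_eq_continuous_at holomorphic_on_imp_continuous_on
        by fastforce
      have "((\<lambda>z. norm (csqrt z)) \<longlongrightarrow> 0) (at 0)"
        by (auto intro!: tendsto_eq_intros)
      then have "isCont csqrt 0"
        unfolding isCont_def csqrt_0 by (rule tendsto_norm_zero_cancel)
      with F True show ?thesis by (metis isCont_o2)
    qed
    then show "continuous_on S (\<lambda>z. F (csqrt z))"
      by (simp add: continuous_at_imp_continuous_on)
  qed simp
qed

lemma phi_P_holomorphic: "phi_P holomorphic_on ball 0 1"
proof -
  define F where "F s = 1 + 2 / (complex_of_real pi)\<^sup>2 * (Ln ((1 + s) / (1 - s)))\<^sup>2" for s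
  have S: "{s. s\<^sup>2 \<in> ball (0::complex) 1} = ball 0 1"
    by (auto simp: norm_power abs_square_less_1)
  have np: "(1 + s) / (1 - s) \<notin> \<real>\<^sub>\<le>\<^sub>0" if "norm s < 1" for s :: complex
    using Re_cayley_pos[OF that] by (auto simp: complex_nonpos_Reals_iff)
  have "F holomorphic_on ball 0 1"
    unfolding F_def using np by (intro holomorphic_intros) auto
  moreover have "F (- s) = F s" if "norm s < 1" for s
  proof -
    have "Ln ((1 - s) / (1 + s)) = Ln (inverse ((1 + s) / (1 - s)))" by simp
    also have "\<dots> = - Ln ((1 + s) / (1 - s))"
      using np[OF that] by (rule Ln_inverse)
    finally show ?thesis by (simp add: F_def)
  qed
  ultimately have "(\<lambda>z. F (csqrt z)) holomorphic_on ball 0 1"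
    by (intro holomorphic_even_csqrt) (auto simp: S norm_power abs_square_less_1)
  then show ?thesis by (simp add: F_def phi_P_def[abs_def])
qed

text \<open>With s^2 = pi^2 (w - 1)/8 the disc |w - 1| < 1/2 corresponds exactly to |s| < pi/4.
  There Re (exp (2s)) > 0, so tanh s lies in the unit disc, and 2s stays in the strip where
  \<open>Ln\<close> inverts \<open>exp\<close>.\<close>

lemma starlike_P_radius:
  assumes R: "0 < R" "R < 1" "disc_min R = 1 / 2"
  shows "class_radius starlike_P class_F3 = R"
proof -
  \<comment> \<open>\<open>T\<close> is \<open>tanh\<close>, and \<open>(tanh (csqrt (\<pi>\<^sup>2 (w - 1) / 8)))\<^sup>2\<close> inverts \<open>phi_P\<close>.\<close>
  define T where "T s = (exp (2 * s) - 1) / (exp (2 * s) + 1)" for s :: complex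
  have Re_exp: "Re (exp (2 * s)) > 0" if "norm s < pi / 4" for s :: complex
    using that abs_Im_le_cmod[of s] unfolding Re_exp
    by (intro mult_pos_pos exp_gt_zero cos_gt_zero_pi) auto
  have nz: "exp (2 * s) + 1 \<noteq> 0" if "norm s < pi / 4" for s :: complex
    using Re_exp[OF that] by (metis add_eq_0_iff add.commute one_complex.sel(1) uminus_complex.sel(1) neg_less_0_iff_less not_one_less_zero)
  have T_less: "norm (T s) < 1" if "norm s < pi / 4" for s
  proof -
    have "(norm (exp (2 * s) - 1))\<^sup>2 < (norm (exp (2 * s) + 1))\<^sup>2"
      unfolding cmod_power2 using Re_exp[OF that] by (simp add: power2_eq_square algebra_simps)
    then have "norm (exp (2 * s) - 1) < norm (exp (2 * s) + 1)"
      using power2_less_imp_less by fastforce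
    then show ?thesis using nz[OF that] by (simp add: T_def norm_divide)
  qed
  have T_minus: "T (- s) = - T s" if "norm s < pi / 4" for s
  proof -
    have "T (- s) = (1 / exp (2 * s) - 1) / (1 / exp (2 * s) + 1)"
      by (simp add: T_def exp_minus inverse_eq_divide)
    also have "\<dots> = ((1 - exp (2 * s)) / exp (2 * s)) / ((exp (2 * s) + 1) / exp (2 * s))"
      by (simp add: diff_divide_distrib add_divide_distrib add.commute)
    also have "\<dots> = - T s"
      unfolding T_def minus_divide_left by simp
    finally show ?thesis .
  qed
  have Ln_T: "Ln ((1 + T s) / (1 - T s)) = 2 * s" if "norm s < pi / 4" for s
  proof -
    have "1 + T s = 2 * exp (2 * s) / (exp (2 * s) + 1)" "1 - T s = 2 / (exp (2 * s) + 1)"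
      using nz[OF that] by (simp_all add: T_def field_simps)
    then have "(1 + T s) / (1 - T s) = exp (2 * s)"
      using nz[OF that] by simp
    also have "Ln \<dots> = 2 * s"
      using that abs_Im_le_cmod[of s] by (intro Ln_exp) auto
    finally show ?thesis .
  qed
  define u where "u w = (of_real pi)\<^sup>2 * (w - 1) / 8" for w :: complex
  have u_ball: "u w \<in> ball 0 ((pi / 4)\<^sup>2)" if "w \<in> ball 1 (1 - 1 / 2)" for w
  proof -
    have "norm (u w) = pi\<^sup>2 * norm (w - 1) / 8"
      by (simp add: u_def norm_mult norm_divide norm_power)
    also have "\<dots> < pi\<^sup>2 * (1 / 2) / 8"
      using that by (intro divide_strict_right_mono mult_strict_left_mono)
        (auto simp: dist_norm norm_minus_commute)
    finally show ?thesis by (simp add: power_divide)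
  qed
  have sq: "s\<^sup>2 \<in> ball 0 ((pi / 4)\<^sup>2) \<longleftrightarrow> norm s < pi / 4" for s :: complex
    using power_mono_iff[of "pi / 4" "norm s" 2]
    by (simp add: norm_power linorder_not_le[symmetric] del: linorder_not_le)
  show ?thesis
  proof (rule starlike_sub_radius[OF R phi_P_holomorphic, where \<psi> = "\<lambda>w. (T (csqrt (u w)))\<^sup>2"])
    have "(\<lambda>s. (T s)\<^sup>2) holomorphic_on {s. s\<^sup>2 \<in> ball 0 ((pi / 4)\<^sup>2)}"
      unfolding sq T_def using nz by (intro holomorphic_intros) auto
    then have "(\<lambda>z. (T (csqrt z))\<^sup>2) holomorphic_on ball 0 ((pi / 4)\<^sup>2)"
      by (intro holomorphic_even_csqrt[where F = "\<lambda>s. (T s)\<^sup>2"]) (use sq T_minus in auto)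
    moreover have "u holomorphic_on ball 1 (1 - 1 / 2)"
      unfolding u_def by (intro holomorphic_intros) auto
    ultimately show "(\<lambda>w. (T (csqrt (u w)))\<^sup>2) holomorphic_on ball 1 (1 - 1 / 2)"
      using holomorphic_on_compose_gen[of u "ball 1 (1 - 1 / 2)" "\<lambda>z. (T (csqrt z))\<^sup>2"] u_ball
      by (force simp: o_def)
    show "(T (csqrt (u 1)))\<^sup>2 = 0" by (simp add: u_def T_def)
    fix w :: complex assume "w \<in> ball 1 (1 - 1 / 2)"
    then have s: "norm (csqrt (u w)) < pi / 4"
      using u_ball sq[of "csqrt (u w)"] by simp
    then show "norm ((T (csqrt (u w)))\<^sup>2) < 1"
      using T_less by (simp add: norm_power real_sq_less_1)
    \<comment> \<open>\<open>csqrt\<close> may return either T s or -T s = T (-s), with s =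
      \<open>csqrt (u w)\<close>; the sign disappears once the logarithm is squared.\<close>
    have "csqrt ((T (csqrt (u w)))\<^sup>2) = T (csqrt (u w)) \<or> csqrt ((T (csqrt (u w)))\<^sup>2) = T (- csqrt (u w))"
      using power2_csqrt[of "(T (csqrt (u w)))\<^sup>2"] T_minus[OF s] by (simp only: power2_eq_iff)
    then have "(Ln ((1 + csqrt ((T (csqrt (u w)))\<^sup>2)) / (1 - csqrt ((T (csqrt (u w)))\<^sup>2))))\<^sup>2 = 4 * u w"
      using Ln_T[OF s] Ln_T[of "- csqrt (u w)"] s by (auto simp: power_mult_distrib)
    then have "phi_P ((T (csqrt (u w)))\<^sup>2) = 1 + 2 / (of_real pi)\<^sup>2 * (4 * u w)"
      by (simp only: phi_P_def)
    also have "\<dots> = w" by (simp add: u_def diff_divide_distrib)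
    finally show "phi_P ((T (csqrt (u w)))\<^sup>2) = w" .
  next
    fix \<zeta> :: complex assume z: "norm \<zeta> < 1"
    show "phi_P \<zeta> \<noteq> of_real (1 / 2)"
    proof
      define Q where "Q = (1 + csqrt \<zeta>) / (1 - csqrt \<zeta>)"
      have Q: "Re Q > 0" unfolding Q_def by (rule Re_cayley_pos) (use z in simp)
      have "2 / (complex_of_real pi)\<^sup>2 * (Ln Q)\<^sup>2 = phi_P \<zeta> - 1"
        by (simp add: phi_P_def Q_def)
      also assume "phi_P \<zeta> = of_real (1 / 2)"
      finally have *: "2 / (complex_of_real pi)\<^sup>2 * (Ln Q)\<^sup>2 = of_real (1 / 2) - 1" .
      \<comment> \<open>The value 1/2 would force Ln Q to be i pi/2 or -i pi/2, but Re Q > 0 keeps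
        the argument strictly between these.\<close>
      have "(Ln Q)\<^sup>2 = (complex_of_real pi)\<^sup>2 / 2 * (2 / (complex_of_real pi)\<^sup>2 * (Ln Q)\<^sup>2)"
        by simp
      also have "\<dots> = (\<i> * of_real (pi / 2))\<^sup>2"
        unfolding * by (simp add: power_mult_distrib power_divide)
      finally have "(Ln Q)\<^sup>2 = (\<i> * of_real (pi / 2))\<^sup>2" .
      then have "Ln Q = \<i> * of_real (pi / 2) \<or> Ln Q = - (\<i> * of_real (pi / 2))"
        by (simp only: power2_eq_iff)
      then have "\<bar>Im (Ln Q)\<bar> = pi / 2"
        by (elim disjE) (simp_all only: Im_i_times uminus_complex.sel Re_complex_of_real, simp_all)
      moreover have "\<bar>Im (Ln Q)\<bar> < pi / 2" using Q Re_Ln_pos_lt_imp by blast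
      ultimately show False by simp
    qed
  qed
qed

text \<open>The disc about c touches the right loop of |w^2 - 1| = 1 at sqrt 2 from inside. The
  constant 2 sqrt 2 / 3 is the centre of curvature of the loop at that point. In terms of s = |w|^2
  and x = Re w the loop is s^2 + 2s < 4x^2, and the disc bounds 2cx from below; the square of this
  bound exceeds c^2 (s^2 + 2s) by two terms whose signs are settled by the two bounds on c.\<close>

lemma lemniscate_disc:
  fixes w :: complex
  assumes c: "2 * sqrt 2 / 3 \<le> c" "c \<le> 1" and w: "norm (w - of_real c) < sqrt 2 - c"
  shows "norm (w\<^sup>2 - 1) < 1" and "Re w > 0"
proof -
  define s x where "s = (norm w)\<^sup>2" and "x = Re w"
  have s2: "sqrt 2 * sqrt 2 = (2::real)" "1 < sqrt 2" by auto
  have c0: "c > 0" using c s2 by linarith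
  have "norm w \<le> norm (w - of_real c) + norm (complex_of_real c)"
    by (metis diff_add_cancel norm_triangle_ineq)
  then have "norm w < sqrt 2" using w c0 by simp
  then have "s < (sqrt 2)\<^sup>2" unfolding s_def by (intro power_strict_mono) auto
  then have s: "s < 2" by simp
  have "(norm (w - of_real c))\<^sup>2 < (sqrt 2 - c)\<^sup>2"
    using w by (intro power_strict_mono) auto
  then have "s - 2 * c * x + c\<^sup>2 < (sqrt 2 - c)\<^sup>2"
    unfolding s_def x_def cmod_power2 by (simp add: power2_eq_square algebra_simps)
  then have x: "2 * sqrt 2 * c - (2 - s) < 2 * c * x"
    by (simp add: power2_eq_square algebra_simps)
  have "s \<ge> 0" by (simp add: s_def)
  have "2 * sqrt 2 * c \<ge> 2 * sqrt 2 * (2 * sqrt 2 / 3)"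
    using c by (intro mult_left_mono) auto
  moreover have "2 * sqrt 2 * (2 * sqrt 2 / 3) = (8 / 3 :: real)" by simp
  ultimately have p: "2 * sqrt 2 * c - (2 - s) > 0" using \<open>s \<ge> 0\<close> by linarith
  then have "0 < c * (2 * x)" using x by simp
  then show "Re w > 0" using c0 by (simp add: x_def zero_less_mult_iff)
  have "(2 * sqrt 2 * c - (2 - s))\<^sup>2 < (2 * c * x)\<^sup>2"
    using x p by (intro power_strict_mono) auto
  moreover have "(2 * sqrt 2 * c - (2 - s))\<^sup>2 = c\<^sup>2 * (s\<^sup>2 + 2 * s)
      + 2 * c * (2 - s) * (3 * (c - 2 * sqrt 2 / 3)) + (2 - s)\<^sup>2 * (1 - c\<^sup>2)"
    by (simp add: power2_eq_square algebra_simps)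
  moreover have "0 \<le> 2 * c * (2 - s) * (3 * (c - 2 * sqrt 2 / 3))"
    using c c0 s by simp
  moreover have "0 \<le> (2 - s)\<^sup>2 * (1 - c\<^sup>2)"
    using c c0 by (simp add: power_le_one)
  ultimately have "c\<^sup>2 * (s\<^sup>2 + 2 * s) < c\<^sup>2 * (4 * x\<^sup>2)"
    by (simp add: power_mult_distrib)
  then have *: "s\<^sup>2 + 2 * s < 4 * x\<^sup>2" using c0 by simp
  have "(norm (w\<^sup>2 - 1))\<^sup>2 = s\<^sup>2 + 2 * s - 4 * x\<^sup>2 + 1"
    unfolding s_def x_def cmod_power2 by (simp add: power2_eq_square algebra_simps)
  then have "(norm (w\<^sup>2 - 1))\<^sup>2 < 1" using * by simp
  then show "norm (w\<^sup>2 - 1) < 1" by (simp add: abs_square_less_1)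
qed

subsection \<open>The lemniscate and numerical bounds\<close>

text \<open>z -> 1 + z/(2 + z) maps the circle |z| = r onto the circle with diameter from 2(1 -
  r)/(2 - r) to 2(1 + r)/(2 + r). Its centre is (4 - 2r^2)/(4 - r^2) and its radius 2r/(4 - r^2).
  About this centre the estimate is sharp at the right end.\<close>

lemma class_F3_s_quot_disc_max:
  assumes f: "f \<in> class_F3" and z: "norm z = r" "r < 1"
  shows "norm (s_quot f z - of_real ((4 - 2 * r\<^sup>2) / (4 - r\<^sup>2))) \<le> disc_max r - (4 - 2 * r\<^sup>2) / (4 - r\<^sup>2)"
proof -
  define c where "c = (4 - 2 * r\<^sup>2) / (4 - r\<^sup>2)"
  have r: "0 \<le> r" "r\<^sup>2 < 1" using z real_sq_less_1[of r] by auto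
  have n2: "0 < norm (2 + z)"
    using norm_two_plus[of z] z by auto
  have c: "disc_max r - c = 2 * r / (1 - r\<^sup>2) + 2 * r / (4 - r\<^sup>2)"
  proof -
    have "2 * (1 + r) / (2 + r) = 2 * (1 + r) * (2 - r) / (4 - r\<^sup>2)"
    proof -
      have "4 - r\<^sup>2 = (2 + r) * (2 - r)" by (simp add: power2_eq_square algebra_simps)
      then show ?thesis using z r by simp
    qed
    then have "2 * (1 + r) / (2 + r) - c = (2 * (1 + r) * (2 - r) - (4 - 2 * r\<^sup>2)) / (4 - r\<^sup>2)"
      by (simp add: c_def diff_divide_distrib)
    also have "2 * (1 + r) * (2 - r) - (4 - 2 * r\<^sup>2) = 2 * r"
      by (simp add: power2_eq_square algebra_simps)
    finally show ?thesis by (simp add: disc_max_def)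
  qed
  have "norm (1 + z / (2 + z) - of_real c) = 2 * r / (4 - r\<^sup>2)"
  proof -
    have zz: "z * cnj z = of_real (r\<^sup>2)"
      using complex_norm_square[of z] z by simp
    define D where "D = complex_of_real (4 - r\<^sup>2)"
    have D: "D = 4 - z * cnj z" "D \<noteq> 0" "2 + z \<noteq> 0"
      using r n2 unfolding zz D_def of_real_eq_0_iff by auto
    have "c = 2 - 4 / (4 - r\<^sup>2)"
      using r by (simp add: c_def field_simps)
    then have "of_real c = 2 - 4 / D" by (simp add: D_def)
    moreover have "1 + z / (2 + z) = 2 - 2 / (2 + z)"
      using D(3) by (simp add: field_simps)
    ultimately have "1 + z / (2 + z) - of_real c = 4 / D - 2 / (2 + z)" by simp
    also have "\<dots> = (4 * (2 + z) - 2 * D) / ((2 + z) * D)"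
      using D(2,3) by (simp add: diff_frac_eq mult.commute)
    \<comment> \<open>The modulus of 2 + cnj z cancels that of 2 + z in the denominator, so the
      distance to the centre is constant on the circle.\<close>
    also have "4 * (2 + z) - 2 * D = of_real 2 * (z * (2 + cnj z))"
      unfolding D(1) by (simp add: algebra_simps)
    finally have "1 + z / (2 + z) - of_real c
        = of_real 2 * (z * (2 + cnj z)) / ((2 + z) * of_real (4 - r\<^sup>2))"
      unfolding D_def .
    then have "norm (1 + z / (2 + z) - of_real c) = 2 * (r * norm (2 + cnj z)) / (norm (2 + z) * (4 - r\<^sup>2))"
      using r z by (simp only: norm_mult norm_divide norm_of_real)
    also have "norm (2 + cnj z) = norm (2 + z)"
      using complex_mod_cnj[of "2 + z"] by simp
    finally show ?thesis using n2 by simp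
  qed
  moreover have "norm (s_quot f z - (1 + z / (2 + z))) \<le> 2 * r / (1 - r\<^sup>2)"
    using class_F3_s_quot(2)[OF f, of z] z by simp
  moreover have "norm (s_quot f z - of_real c)
      \<le> norm (s_quot f z - (1 + z / (2 + z))) + norm (1 + z / (2 + z) - of_real c)"
    using norm_triangle_ineq[of "s_quot f z - (1 + z / (2 + z))" "1 + z / (2 + z) - of_real c"] by simp
  ultimately show ?thesis unfolding c c_def[symmetric] by simp
qed

lemma phi_L_holomorphic: "phi_L holomorphic_on ball 0 1"
proof -
  have "1 + z \<notin> \<real>\<^sub>\<le>\<^sub>0" if "norm z < 1" for z :: complex
    using that abs_Re_le_cmod[of z] by (auto simp: complex_nonpos_Reals_iff)
  then show ?thesis unfolding phi_L_def[abs_def] by (intro holomorphic_intros) auto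
qed

text \<open>The bound R < 1/5 keeps the moving centre in the range where the disc with rightmost
  point sqrt 2 fits into the loop.\<close>

lemma starlike_L_radius:
  assumes R: "0 < R" "R < 1 / 5" "disc_max R = sqrt 2"
  shows "class_radius starlike_L class_F3 = R"
proof (rule class_radius_F3_eq)
  fix g assume g: "g \<in> class_A" "s_quot g holomorphic_on ball 0 1"
    and near: "\<And>z. z \<in> ball 0 1 \<Longrightarrow> \<exists>f\<in>class_F3. \<exists>w. norm w < R \<and> s_quot g z = s_quot f w"
  have D: "norm ((s_quot g z)\<^sup>2 - 1) < 1 \<and> Re (s_quot g z) > 0" if z: "z \<in> ball 0 1" for z
  proof -
    obtain f w where fw: "f \<in> class_F3" "norm w < R" "s_quot g z = s_quot f w"
      using near[OF z] by blast
    define c where "c = (4 - 2 * (norm w)\<^sup>2) / (4 - (norm w)\<^sup>2)"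
    have "(norm w)\<^sup>2 \<le> (1 / 5)\<^sup>2"
      using fw R by (intro power_mono) auto
    then have w2: "(norm w)\<^sup>2 \<le> 1 / 25" by (simp add: power2_eq_square)
    \<comment> \<open>Generous roundings: c is at least 98/99, while 2 * 1.42 / 3 is below
      0.95.\<close>
    have "sqrt 2 \<le> 1.42" by (rule real_le_lsqrt) (auto simp: power2_eq_square)
    moreover have "0.96 \<le> c" "c \<le> 1"
      using w2 by (auto simp: c_def field_simps)
    ultimately have c: "2 * sqrt 2 / 3 \<le> c" "c \<le> 1" by auto
    have "norm (s_quot f w - of_real c) \<le> disc_max (norm w) - c"
      using class_F3_s_quot_disc_max[OF fw(1) refl, of w] fw(2) R by (simp add: c_def)
    also have "\<dots> < sqrt 2 - c"
      using disc_max_strict_mono[of "norm w" R] fw(2) R by simp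
    finally show ?thesis
      using lemniscate_disc[OF c] fw(3) by simp
  qed
  show "g \<in> starlike_L"
  proof (rule starlike_sub_I[OF g phi_L_holomorphic,
        where \<psi> = "\<lambda>w. w\<^sup>2 - 1" and D = "{w. norm (w\<^sup>2 - 1) < 1 \<and> Re w > 0}"])
    show "phi_L (w\<^sup>2 - 1) = w" if "w \<in> {w. norm (w\<^sup>2 - 1) < 1 \<and> Re w > 0}" for w
      using that by (auto simp: phi_L_def csqrt_square)
  qed (use D in \<open>auto intro!: holomorphic_intros\<close>)
next
  fix g and z :: complex assume g: "g \<in> starlike_L" "z \<in> ball 0 1"
  obtain \<zeta> where \<zeta>: "norm \<zeta> < 1" "s_quot g z = phi_L \<zeta>"
    using starlike_sub_E[OF g] .
  show "s_quot g z \<noteq> s_quot extremal_F3 (of_real R)"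
  proof
    assume "s_quot g z = s_quot extremal_F3 (of_real R)"
    then have "csqrt (1 + \<zeta>) = of_real (sqrt 2)"
      using \<zeta>(2) s_quot_extremal_F3_max[of R] R by (simp add: phi_L_def)
    then have "1 + \<zeta> = (of_real (sqrt 2))\<^sup>2" by (metis power2_csqrt)
    then have "\<zeta> = 1" by (simp flip: of_real_power)
    then show False using \<zeta>(1) by simp
  qed
qed (use R in auto)

section \<open>Numerical location of the roots\<close>

lemma disc_min_root_bounds:
  assumes R: "0 < R" "R < 1" "disc_min R = \<alpha>"
    and "0 \<le> a" "a < 1" "disc_min a > \<alpha>" and "0 \<le> b" "b < 1" "disc_min b < \<alpha>"
  shows "a < R" "R < b"
  using assms disc_min_strict_antimono[of a R] disc_min_strict_antimono[of R a]
    disc_min_strict_antimono[of b R] disc_min_strict_antimono[of R b]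
  by (cases a R rule: linorder_cases; cases b R rule: linorder_cases; auto)+

lemma disc_max_root_bounds:
  assumes R: "0 < R" "R < 1" "disc_max R = \<alpha>"
    and "0 \<le> a" "a < 1" "disc_max a < \<alpha>" and "0 \<le> b" "b < 1" "disc_max b > \<alpha>"
  shows "a < R" "R < b"
  using assms disc_max_strict_mono[of a R] disc_max_strict_mono[of R a]
    disc_max_strict_mono[of b R] disc_max_strict_mono[of R b]
  by (cases a R rule: linorder_cases; cases b R rule: linorder_cases; auto)+

lemma sqrt2_bounds: "1.414213 < sqrt 2" "sqrt 2 < 1.414214"
  by (rule real_less_rsqrt real_less_lsqrt; simp add: power2_eq_square)+

lemma exp_1_bounds: "2.71828 < exp (1::real)" "exp (1::real) < 2.71829"
  using abs_le_D1[OF e_approx_32] abs_le_D2[OF e_approx_32] by simp_all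

lemma sin_1_bounds: "0.84147 < sin (1::real)" "sin (1::real) < 0.84148"
proof -
  \<comment> \<open>The remainder 1/10! is below 3 * 10^-7, small enough for the gap of just under
    10^-6 between 0.84147 and sin 1.\<close>
  have "\<bar>sin 1 - (\<Sum>m<10. sin_coeff m * 1 ^ m)\<bar> \<le> inverse (fact 10) * \<bar>1::real\<bar> ^ 10"
    by (rule Maclaurin_sin_bound)
  then have "\<bar>sin 1 - (1 - 1 / 6 + 1 / 120 - 1 / 5040 + 1 / 362880)\<bar> \<le> (1 / 3628800 :: real)"
    by (simp add: sin_coeff_def fact_numeral lessThan_nat_numeral lessThan_Suc)
  then show "0.84147 < sin (1::real)" "sin (1::real) < 0.84148"
    unfolding abs_le_iff by auto
qed

text \<open>Both radii are the unique R in (0, 1) with disc_min R = \<alpha>. For the decimal value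
  x, \<open>e\<close> is half a unit of its last digit, and two evaluations of the decreasing
  function enclose R.\<close>

lemma disc_min_radius:
  assumes "\<And>R. 0 < R \<Longrightarrow> R < 1 \<Longrightarrow> disc_min R = \<alpha> \<Longrightarrow> class_radius G class_F3 = R"
    and \<alpha>: "0 \<le> \<alpha>" "\<alpha> < 1"
    and "0 \<le> x - e" "disc_min (x - e) > \<alpha>" and "x + e < 1" "disc_min (x + e) < \<alpha>" and "0 < e"
  shows "class_radius G class_F3 = class_radius (starlike_order \<alpha>) class_F3 \<and>
    \<bar>class_radius G class_F3 - x\<bar> < e"
proof -
  obtain R where R: "0 < R" "R < 1" "disc_min R = \<alpha>"
    using disc_min_root_exists[OF \<alpha>(2)] by blast
  moreover have "x - e < R" "R < x + e"
    using disc_min_root_bounds[OF R, of "x - e" "x + e"] assms by auto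
  ultimately show ?thesis
    using assms(1)[OF R] starlike_order_radius[OF \<alpha>(1) R] by (simp add: abs_less_iff)
qed

theorem theorem4p1:
  shows
   "(\<forall>\<alpha>. 0 \<le> \<alpha> \<and> \<alpha> < 1 \<longrightarrow>
       smallest_positive_root
         (\<lambda>r. (2 - \<alpha>) * r ^ 3 + 2 * \<alpha> * r ^ 2 + (\<alpha> - 6) * r + 2 - 2 * \<alpha>)
         (class_radius (starlike_order \<alpha>) class_F3)) \<and>
    (smallest_positive_root
         (\<lambda>r. (sqrt 2 - 2) * r ^ 3 + 2 * sqrt 2 * r ^ 2 + (6 - sqrt 2) * r + 2 - 2 * sqrt 2)
         (class_radius starlike_L class_F3) \<and>
       \<bar>class_radius starlike_L class_F3 - 0.1645\<bar> < 0.00005) \<and>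
    (class_radius starlike_P class_F3 = class_radius (starlike_order (1 / 2)) class_F3 \<and>
       \<bar>class_radius starlike_P class_F3 - 0.19028\<bar> < 0.000005) \<and>
    (class_radius starlike_e class_F3 = class_radius (starlike_order (1 / exp 1)) class_F3 \<and>
       \<bar>class_radius starlike_e class_F3 - 0.2355\<bar> < 0.00005) \<and>
    (class_radius starlike_sin class_F3 = class_radius (starlike_order (1 - sin 1)) class_F3 \<and>
       \<bar>class_radius starlike_sin class_F3 - 0.3017\<bar> < 0.00005) \<and>
    (class_radius starlike_lune class_F3 = class_radius (starlike_order (sqrt 2 - 1)) class_F3 \<and>
       \<bar>class_radius starlike_lune class_F3 - 0.2199\<bar> < 0.00005) \<and>
    (class_radius starlike_R class_F3 = class_radius (starlike_order (2 * (sqrt 2 - 1))) class_F3 \<and>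
       \<bar>class_radius starlike_R class_F3 - 0.0679\<bar> < 0.00005) \<and>
    (class_radius starlike_C class_F3 = class_radius (starlike_order (1 / 3)) class_F3 \<and>
       \<bar>class_radius starlike_C class_F3 - 0.2469\<bar> < 0.00005)"
proof (intro conjI[of "\<forall>\<alpha>. _ \<alpha>"] conjI[of "_ \<and> _"] allI impI)
  fix \<alpha> :: real assume \<alpha>: "0 \<le> \<alpha> \<and> \<alpha> < 1"
  then obtain R where R: "0 < R" "R < 1" "disc_min R = \<alpha>"
    using disc_min_root_exists by blast
  then show "smallest_positive_root
         (\<lambda>r. (2 - \<alpha>) * r ^ 3 + 2 * \<alpha> * r ^ 2 + (\<alpha> - 6) * r + 2 - 2 * \<alpha>)
         (class_radius (starlike_order \<alpha>) class_F3)"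
    using disc_min_smallest_root[OF R] starlike_order_radius[OF _ R] \<alpha> by simp
next
  obtain R where R: "0 < R" "R < 1" "disc_max R = sqrt 2"
    using disc_max_root_exists[of "sqrt 2"] by auto
  \<comment> \<open>The enclosure serves twice: it proves the decimal value and supplies the bound R
    < 1/5 required by \<open>starlike_L_radius\<close>.\<close>
  have "disc_max 0.16445 < sqrt 2" "sqrt 2 < disc_max 0.16455"
    using sqrt2_bounds by (simp_all add: disc_max_def power2_eq_square)
  then have b: "0.16445 < R" "R < 0.16455"
    using disc_max_root_bounds[OF R, of "0.16445" "0.16455"] by simp_all
  then have "\<bar>R - 0.1645\<bar> < 0.00005"
    unfolding abs_less_iff by simp
  moreover from b have "class_radius starlike_L class_F3 = R"
    using starlike_L_radius R by simp
  ultimately show "smallest_positive_root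
         (\<lambda>r. (sqrt 2 - 2) * r ^ 3 + 2 * sqrt 2 * r ^ 2 + (6 - sqrt 2) * r + 2 - 2 * sqrt 2)
         (class_radius starlike_L class_F3) \<and>
       \<bar>class_radius starlike_L class_F3 - 0.1645\<bar> < 0.00005"
    using disc_max_smallest_root[OF R] by simp
next
  show "class_radius starlike_P class_F3 = class_radius (starlike_order (1 / 2)) class_F3 \<and>
       \<bar>class_radius starlike_P class_F3 - 0.19028\<bar> < 0.000005"
    by (rule disc_min_radius[OF starlike_P_radius])
      (simp_all add: disc_min_def power2_eq_square)
  have "0 < exp (1::real)" "36787 / 100000 < 1 / exp (1::real)" "1 / exp (1::real) < 36789 / 100000"
    using exp_1_bounds by (simp_all add: field_simps)
  then show "class_radius starlike_e class_F3 = class_radius (starlike_order (1 / exp 1)) class_F3 \<and>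
       \<bar>class_radius starlike_e class_F3 - 0.2355\<bar> < 0.00005"
    by (intro disc_min_radius[OF starlike_e_radius])
      (simp_all add: disc_min_def power2_eq_square)
  show "class_radius starlike_sin class_F3 = class_radius (starlike_order (1 - sin 1)) class_F3 \<and>
       \<bar>class_radius starlike_sin class_F3 - 0.3017\<bar> < 0.00005"
    by (rule disc_min_radius[OF starlike_sin_radius];
        use sin_1_bounds in \<open>simp add: disc_min_def power2_eq_square\<close>)
  show "class_radius starlike_lune class_F3 = class_radius (starlike_order (sqrt 2 - 1)) class_F3 \<and>
       \<bar>class_radius starlike_lune class_F3 - 0.2199\<bar> < 0.00005"
    by (rule disc_min_radius[OF starlike_lune_radius];
        use sqrt2_bounds in \<open>simp add: disc_min_def power2_eq_square\<close>)
  show "class_radius starlike_R class_F3 = class_radius (starlike_order (2 * (sqrt 2 - 1))) class_F3 \<and>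
       \<bar>class_radius starlike_R class_F3 - 0.0679\<bar> < 0.00005"
    by (rule disc_min_radius[OF starlike_R_radius];
        use sqrt2_bounds in \<open>simp add: disc_min_def power2_eq_square\<close>)
  show "class_radius starlike_C class_F3 = class_radius (starlike_order (1 / 3)) class_F3 \<and>
       \<bar>class_radius starlike_C class_F3 - 0.2469\<bar> < 0.00005"
    by (rule disc_min_radius[OF starlike_C_radius])
      (simp_all add: disc_min_def power2_eq_square)
qed

end
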